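(* Let $\mathcal{X}_2,\mathcal{Y}_2$ be finite non-empty sets. Assume that the space $\mathrm{DMC}_{\ast,\ast}^{(s)}$ is endowed with the strong topology $\mathcal{T}_{s,\ast,\ast}^{(s)}$, that $\mathrm{DMC}_{\mathcal{X}_2,\mathcal{Y}_2}^{(s)}$ is endowed with the quotient topology $\mathcal{T}_{\mathcal{X}_2,\mathcal{Y}_2}^{(s)}$, and that products carry the product topology. Then: (1) The channel sum $(\hat W_1,\overline W_2)\mapsto\hat W_1\oplus\overline W_2$ from $\mathrm{DMC}_{\ast,\ast}^{(s)}\times\mathrm{DMC}_{\mathcal{X}_2,\mathcal{Y}_2}^{(s)}$ to $\mathrm{DMC}_{\ast,\ast}^{(s)}$ is continuous. (2) The channel product $(\hat W_1,\overline W_2)\mapsto\hat W_1\otimes\overline W_2$ from $\mathrm{DMC}_{\ast,\ast}^{(s)}\times\mathrm{DMC}_{\mathcal{X}_2,\mathcal{Y}_2}^{(s)}$ to $\mathrm{DMC}_{\ast,\ast}^{(s)}$ is continuous.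
   Context: For finite sets $\mathcal{X},\mathcal{Y}$, $\mathrm{DMC}_{\mathcal{X},\mathcal{Y}}$ is the set of channels from $\mathcal{X}$ to $\mathcal{Y}$, i.e. families $W=(W(y|x))_{x\in\mathcal{X},y\in\mathcal{Y}}$ of non-negative reals with $\sum_{y}W(y|x)=1$ for every $x$, with the topology $\mathcal{T}_{\mathcal{X},\mathcal{Y}}$ inherited from $\mathbb{R}^{\mathcal{X}\times\mathcal{Y}}$. Composition: $(V\circ W)(z|x)=\sum_yV(z|y)W(y|x)$. $[n]=\{1,\dots,n\}$. $W'\in\mathrm{DMC}_{\mathcal{X}',\mathcal{Y}'}$ contains $W\in\mathrm{DMC}_{\mathcal{X},\mathcal{Y}}$ if there exist $k\geq 1$, a probability distribution $\alpha$ on $[k]$, $R_i\in\mathrm{DMC}_{\mathcal{X},\mathcal{X}'}$ and $T_i\in\mathrm{DMC}_{\mathcal{Y}',\mathcal{Y}}$ such that $W=\sum_{i=1}^k\alpha(i)\,T_i\circ W'\circ R_i$. Two channels are Shannon-equivalent if each contains the other. $\mathrm{DMC}_{\mathcal{X},\mathcal{Y}}^{(s)}$ is the quotient of $\mathrm{DMC}_{\mathcal{X},\mathcal{Y}}$ by Shannon-equivalence and $\mathcal{T}_{\mathcal{X},\mathcal{Y}}^{(s)}$ is its quotient topology. Let $\mathrm{DMC}_{\ast,\ast}=\coprod_{n,m\ge1}\mathrm{DMC}_{[n],[m]}$ with the disjoint union topology $\mathcal{T}_{s,\ast,\ast}$, and let $\mathrm{DMC}_{\ast,\ast}^{(s)}$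 be the quotient of $\mathrm{DMC}_{\ast,\ast}$ by Shannon-equivalence. The strong topology $\mathcal{T}_{s,\ast,\ast}^{(s)}$ is the quotient topology of $\mathcal{T}_{s,\ast,\ast}$. For $W_1\in\mathrm{DMC}_{\mathcal{X}_1,\mathcal{Y}_1}$ and $W_2\in\mathrm{DMC}_{\mathcal{X}_2,\mathcal{Y}_2}$: the channel sum $W_1\oplus W_2\in\mathrm{DMC}_{\mathcal{X}_1\coprod\mathcal{X}_2,\mathcal{Y}_1\coprod\mathcal{Y}_2}$ is $(W_1\oplus W_2)(y,i|x,j)=W_i(y|x)$ if $i=j$ and $0$ otherwise (with $\mathcal{X}_1\coprod\mathcal{X}_2=(\mathcal{X}_1\times\{1\})\cup(\mathcal{X}_2\times\{2\})$); the channel product $W_1\otimes W_2\in\mathrm{DMC}_{\mathcal{X}_1\times\mathcal{X}_2,\mathcal{Y}_1\times\mathcal{Y}_2}$ is $(W_1\otimes W_2)(y_1,y_2|x_1,x_2)=W_1(y_1|x_1)W_2(y_2|x_2)$. It is known (Shannon) that the Shannon-equivalence classes of $W_1\oplus W_2$ and $W_1\otimes W_2$ depend only on those of $W_1$ and $W_2$. For a class $\hat W_1\in\mathrm{DMC}_{\ast,\ast}^{(s)}$ of $W_1$ and a class $\overline W_2\in\mathrm{DMC}_{\mathcal{X}_2,\mathcal{Y}_2}^{(s)}$ of $W_2$, $\hat W_1\oplus\overline W_2$ (resp. $\hat W_1\otimes\overline W_2$) is the element of $\mathrm{DMC}_{\ast,\ast}^{(s)}$ consisting of the channels in $\mathrm{DMC}_{\ast,\ast}$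 that are Shannon-equivalent to $W_1\oplus W_2$ (resp. $W_1\otimes W_2$); such channels exist, by relabelling the finite alphabets as $[n]$ and $[m]$. *)

theory Defs
  imports "HOL-Analysis.Analysis"
begin

section \<open>Channels\<close>

text \<open>
  \<open>W (x, y)\<close> stands for the transition probability \<open>W(y|x)\<close>. A channel is extensional, i.e. it
  takes the value \<open>undefined\<close> outside \<open>X \<times> Y\<close>, so that it is a point of the space
  \<open>\<real>\<^sup>X\<^sup>\<times>\<^sup>Y\<close> as represented by \<open>product_topology\<close>.
\<close>

type_synonym ('x, 'y) channel = "'x \<times> 'y \<Rightarrow> real"

definition DMC :: "'x set \<Rightarrow> 'y set \<Rightarrow> ('x, 'y) channel set" where
  "DMC X Y = {W \<in> extensional (X \<times> Y).
     (\<forall>x\<in>X. \<forall>y\<in>Y. 0 \<le> W (x, y)) \<and> (\<forall>x\<in>X. (\<Sum>y\<in>Y. W (x, y)) = 1)}"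

definition DMC_topology :: "'x set \<Rightarrow> 'y set \<Rightarrow> ('x, 'y) channel topology" where
  "DMC_topology X Y =
     subtopology (product_topology (\<lambda>_. euclideanreal) (X \<times> Y)) (DMC X Y)"

text \<open>\<open>channel_comp X Y Z V W\<close> is the channel \<open>V \<circ> W\<close> from \<open>X\<close> via \<open>Y\<close> to \<open>Z\<close>: first \<open>W\<close>, then \<open>V\<close>.\<close>

definition channel_comp ::
  "'x set \<Rightarrow> 'y set \<Rightarrow> 'z set \<Rightarrow> ('y, 'z) channel \<Rightarrow> ('x, 'y) channel \<Rightarrow> ('x, 'z) channel" where
  "channel_comp X Y Z V W = (\<lambda>(x, z)\<in>X \<times> Z. \<Sum>y\<in>Y. V (y, z) * W (x, y))"

definition channel_sum ::
  "'a set \<Rightarrow> 'b set \<Rightarrow> 'c set \<Rightarrow> 'd set \<Rightarrow> ('a, 'b) channel \<Rightarrow> ('c, 'd) channel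
     \<Rightarrow> ('a + 'c, 'b + 'd) channel" where
  "channel_sum X1 Y1 X2 Y2 W1 W2 = (\<lambda>p\<in>(X1 <+> X2) \<times> (Y1 <+> Y2).
     case p of
       (Inl x, Inl y) \<Rightarrow> W1 (x, y)
     | (Inr x, Inr y) \<Rightarrow> W2 (x, y)
     | _ \<Rightarrow> 0)"

definition channel_prod ::
  "'a set \<Rightarrow> 'b set \<Rightarrow> 'c set \<Rightarrow> 'd set \<Rightarrow> ('a, 'b) channel \<Rightarrow> ('c, 'd) channel
     \<Rightarrow> ('a \<times> 'c, 'b \<times> 'd) channel" where
  "channel_prod X1 Y1 X2 Y2 W1 W2 = (\<lambda>((x1, x2), (y1, y2))\<in>(X1 \<times> X2) \<times> (Y1 \<times> Y2).
     W1 (x1, y1) * W2 (x2, y2))"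

section \<open>Shannon ordering and Shannon equivalence\<close>

text \<open>\<open>channel_contains X' Y' W' X Y W\<close>: the channel \<open>W'\<close> from \<open>X'\<close> to \<open>Y'\<close> contains the channel
  \<open>W\<close> from \<open>X\<close> to \<open>Y\<close>.\<close>

definition channel_contains ::
  "'a set \<Rightarrow> 'b set \<Rightarrow> ('a, 'b) channel \<Rightarrow> 'x set \<Rightarrow> 'y set \<Rightarrow> ('x, 'y) channel \<Rightarrow> bool" where
  "channel_contains X' Y' W' X Y W \<longleftrightarrow>
     W' \<in> DMC X' Y' \<and> W \<in> DMC X Y \<and>
     (\<exists>k\<ge>1. \<exists>(\<alpha> :: nat \<Rightarrow> real) R T.
        (\<forall>i\<in>{1..k}. 0 \<le> \<alpha> i) \<and> (\<Sum>i\<in>{1..k}. \<alpha> i) = 1 \<and>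
        (\<forall>i\<in>{1..k}. R i \<in> DMC X X' \<and> T i \<in> DMC Y' Y) \<and>
        (\<forall>x\<in>X. \<forall>y\<in>Y. W (x, y) =
           (\<Sum>i\<in>{1..k}. \<alpha> i *
              channel_comp X Y' Y (T i) (channel_comp X X' Y' W' (R i)) (x, y))))"

definition shannon_equiv ::
  "'a set \<Rightarrow> 'b set \<Rightarrow> ('a, 'b) channel \<Rightarrow> 'x set \<Rightarrow> 'y set \<Rightarrow> ('x, 'y) channel \<Rightarrow> bool" where
  "shannon_equiv X' Y' W' X Y W \<longleftrightarrow>
     channel_contains X' Y' W' X Y W \<and> channel_contains X Y W X' Y' W'"

section \<open>Quotient topology\<close>

text \<open>A set of \<open>r\<close>-classes is open iff its preimage under the projection to classes is open.\<close>

definition quotient_topology :: "'a topology \<Rightarrow> ('a \<times> 'a) set \<Rightarrow> 'a set topology" where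
  "quotient_topology T r =
     topology (\<lambda>U. U \<subseteq> topspace T // r \<and> openin T {x \<in> topspace T. r `` {x} \<in> U})"

lemma istopology_quotient_topology:
  "istopology (\<lambda>U. U \<subseteq> topspace T // r \<and> openin T {x \<in> topspace T. r `` {x} \<in> U})"
proof -
  have 1: "{x \<in> topspace T. r `` {x} \<in> U \<inter> V} =
      {x \<in> topspace T. r `` {x} \<in> U} \<inter> {x \<in> topspace T. r `` {x} \<in> V}" for U V
    by auto
  have 2: "{x \<in> topspace T. r `` {x} \<in> \<Union>\<K>} =
      (\<Union>K\<in>\<K>. {x \<in> topspace T. r `` {x} \<in> K})" for \<K>
    by auto
  show ?thesis
    unfolding istopology_def 1 2 by blast
qed

lemma openin_quotient_topology:
  "openin (quotient_topology T r) U \<longleftrightarrow>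
     U \<subseteq> topspace T // r \<and> openin T {x \<in> topspace T. r `` {x} \<in> U}"
  by (simp add: quotient_topology_def istopology_quotient_topology)

lemma topspace_quotient_topology [simp]:
  "topspace (quotient_topology T r) = topspace T // r"
proof (rule subset_antisym)
  show "topspace (quotient_topology T r) \<subseteq> topspace T // r"
    using openin_quotient_topology openin_topspace by blast
  have "{x \<in> topspace T. r `` {x} \<in> topspace T // r} = topspace T"
    by (auto intro: quotientI)
  then show "topspace T // r \<subseteq> topspace (quotient_topology T r)"
    by (intro openin_subset) (simp add: openin_quotient_topology)
qed

lemma quotient_map_quotient_topology:
  "quotient_map T (quotient_topology T r) (\<lambda>x. r `` {x})"
  by (auto simp: quotient_map_def openin_quotient_topology quotient_def)

section \<open>Spaces of Shannon-equivalent channels\<close>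

text \<open>By definition of \<open>channel_contains\<close>, this is a relation on \<open>DMC X Y\<close>.\<close>

definition shannon_rel :: "'x set \<Rightarrow> 'y set \<Rightarrow> (('x, 'y) channel \<times> ('x, 'y) channel) set" where
  "shannon_rel X Y = {(W, W'). shannon_equiv X Y W X Y W'}"

definition DMC_s_topology :: "'x set \<Rightarrow> 'y set \<Rightarrow> ('x, 'y) channel set topology" where
  "DMC_s_topology X Y = quotient_topology (DMC_topology X Y) (shannon_rel X Y)"

text \<open>A point \<open>((n, m), W)\<close> of the disjoint union is a channel \<open>W\<close> from \<open>{1..n}\<close> to \<open>{1..m}\<close>.\<close>

type_synonym tagged_channel = "(nat \<times> nat) \<times> (nat, nat) channel"

definition DMC_star :: "tagged_channel set" where
  "DMC_star = (SIGMA (n, m):{1..} \<times> {1..}. DMC {1..n} {1..m})"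

definition DMC_star_topology :: "tagged_channel topology" where
  "DMC_star_topology =
     sum_topology (\<lambda>(n, m). DMC_topology {1..n} {1..m}) ({1..} \<times> {1..})"

definition shannon_rel_star :: "(tagged_channel \<times> tagged_channel) set" where
  "shannon_rel_star = {(((n, m), W), ((n', m'), W')).
     ((n, m), W) \<in> DMC_star \<and> ((n', m'), W') \<in> DMC_star \<and>
     shannon_equiv {1..n} {1..m} W {1..n'} {1..m'} W'}"

definition DMC_star_s_topology :: "tagged_channel set topology" where
  "DMC_star_s_topology = quotient_topology DMC_star_topology shannon_rel_star"

lemma topspace_DMC_topology [simp]: "topspace (DMC_topology X Y) = DMC X Y"
  by (auto simp: DMC_topology_def DMC_def PiE_def)

lemma topspace_DMC_star_topology [simp]: "topspace DMC_star_topology = DMC_star"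
  by (auto simp: DMC_star_topology_def DMC_star_def)

text \<open>
  The tagged channels equivalent to the sum (product) of representatives. As the class of the
  sum (product) does not depend on the representatives, the set below is the class obtained from
  any choice of them.
\<close>

definition class_sum ::
  "'a set \<Rightarrow> 'b set \<Rightarrow> tagged_channel set \<Rightarrow> ('a, 'b) channel set \<Rightarrow> tagged_channel set" where
  "class_sum X2 Y2 C1 C2 = {((n, m), W). ((n, m), W) \<in> DMC_star \<and>
     (\<exists>n1 m1 W1 W2. ((n1, m1), W1) \<in> C1 \<and> W2 \<in> C2 \<and>
        shannon_equiv {1..n} {1..m} W ({1..n1} <+> X2) ({1..m1} <+> Y2)
          (channel_sum {1..n1} {1..m1} X2 Y2 W1 W2))}"

definition class_prod ::
  "'a set \<Rightarrow> 'b set \<Rightarrow> tagged_channel set \<Rightarrow> ('a, 'b) channel set \<Rightarrow> tagged_channel set" where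
  "class_prod X2 Y2 C1 C2 = {((n, m), W). ((n, m), W) \<in> DMC_star \<and>
     (\<exists>n1 m1 W1 W2. ((n1, m1), W1) \<in> C1 \<and> W2 \<in> C2 \<and>
        shannon_equiv {1..n} {1..m} W ({1..n1} \<times> X2) ({1..m1} \<times> Y2)
          (channel_prod {1..n1} {1..m1} X2 Y2 W1 W2))}"

end

theory Submission
  imports Defs
begin

text \<open>
  Every channel is a mixture of deterministic ones, so \<open>W'\<close> contains \<open>W\<close> iff \<open>W\<close> is obtained
  from \<open>W'\<close> by a mixture, over the finitely many pairs of maps \<open>X \<rightarrow> X'\<close> and \<open>Y' \<rightarrow> Y\<close>, of
  relabellings of inputs and outputs. The mixing weights range over a compact simplex, so
  Shannon equivalence is a closed relation on the compact Hausdorff space \<open>DMC X Y\<close>, and the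
  quotient is compact Hausdorff. As the disjoint union of the \<open>DMC [n] [m]\<close> is locally compact
  Hausdorff too, Whitehead's theorem, used once in each factor, shows that the product of the two
  quotient maps is again a quotient map. Continuity can therefore be tested on representatives,
  where the sum and the product are given by polynomial formulas on each component.
\<close>

section \<open>Mixtures of deterministic channels\<close>

lemma DMC_nonneg: "W \<in> DMC X Y \<Longrightarrow> x \<in> X \<Longrightarrow> y \<in> Y \<Longrightarrow> 0 \<le> W (x, y)"
  by (simp add: DMC_def)

lemma DMC_sum: "W \<in> DMC X Y \<Longrightarrow> x \<in> X \<Longrightarrow> (\<Sum>y\<in>Y. W (x, y)) = 1"
  by (simp add: DMC_def)

lemma DMC_le_1:
  assumes "finite Y" "W \<in> DMC X Y" "x \<in> X" "y \<in> Y"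
  shows "W (x, y) \<le> 1"
  using member_le_sum[of y Y "\<lambda>y. W (x, y)"] assms by (simp add: DMC_nonneg DMC_sum)

lemma sum_of_bool_delta:
  fixes h :: "'a \<Rightarrow> real"
  assumes "finite A"
  shows "(\<Sum>a\<in>A. of_bool (b = a) * h a) = (if b \<in> A then h b else 0)"
    and "(\<Sum>a\<in>A. h a * of_bool (b = a)) = (if b \<in> A then h b else 0)"
  proof -
  have "of_bool (b = a) * h a = (if b = a then h a else 0)"
    and "h a * of_bool (b = a) = (if b = a then h a else 0)" for a
    by simp_all
  then show "(\<Sum>a\<in>A. of_bool (b = a) * h a) = (if b \<in> A then h b else 0)"
    and "(\<Sum>a\<in>A. h a * of_bool (b = a)) = (if b \<in> A then h b else 0)"
    using assms by (simp_all only: sum.delta')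
qed

definition det_channel :: "'x set \<Rightarrow> 'y set \<Rightarrow> ('x \<Rightarrow> 'y) \<Rightarrow> ('x, 'y) channel" where
  "det_channel X Y f = (\<lambda>(x, y)\<in>X \<times> Y. of_bool (f x = y))"

lemma det_channel_in_DMC:
  assumes "finite Y" "f \<in> X \<rightarrow> Y"
  shows "det_channel X Y f \<in> DMC X Y"
  using assms by (auto simp: det_channel_def DMC_def Pi_iff of_bool_def sum.delta')

text \<open>Precomposing with \<open>f\<close> replaces the input \<open>x\<close> by
  \<open>f x\<close>; postcomposing with \<open>g\<close> adds up the outputs in the fibre of
  \<open>g\<close> over \<open>y\<close>. Writing the fibre as an indicator keeps the summation set
  independent of \<open>g\<close>, so that sums over maps can later be interchanged with it.\<close>

lemma channel_comp_det_channel: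
  assumes "finite X'" "f \<in> X \<rightarrow> X'" "x \<in> X" "y \<in> Y"
  shows "channel_comp X Y' Y (det_channel Y' Y g) (channel_comp X X' Y' W (det_channel X X' f)) (x, y)
    = (\<Sum>y'\<in>Y'. of_bool (g y' = y) * W (f x, y'))"
  using assms
  by (auto simp: channel_comp_def det_channel_def sum_of_bool_delta Pi_iff intro!: sum.cong)

text \<open>Deterministic channels are channels, so a weighted family of pairs of maps is an
  instance of the definition once \<open>I\<close> is renumbered as \<open>{1..card I}\<close>. A
  general finite index set allows mixtures to be indexed by maps, or by pairs of independent
  choices.\<close>

lemma channel_containsI:
  assumes fin: "finite X'" "finite Y'" "finite Y" "finite I"
    and W: "W' \<in> DMC X' Y'" "W \<in> DMC X Y"
    and \<mu>: "\<And>i. i \<in> I \<Longrightarrow> 0 \<le> \<mu> i" "(\<Sum>i\<in>I. \<mu> i) = 1"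
    and f: "\<And>i. i \<in> I \<Longrightarrow> f i \<in> X \<rightarrow> X'" and g: "\<And>i. i \<in> I \<Longrightarrow> g i \<in> Y' \<rightarrow> Y"
    and eq: "\<And>x y. x \<in> X \<Longrightarrow> y \<in> Y \<Longrightarrow>
      W (x, y) = (\<Sum>i\<in>I. \<mu> i * (\<Sum>y'\<in>Y'. of_bool (g i y' = y) * W' (f i x, y')))"
  shows "channel_contains X' Y' W' X Y W"
proof -
  obtain h where h: "bij_betw h {1..card I} I"
    using ex_bij_betw_nat_finite_1[OF \<open>finite I\<close>] by blast
  have hI: "h j \<in> I" if "j \<in> {1..card I}" for j
    using h that by (auto simp: bij_betw_def)
  \<comment> \<open>An empty family would have total weight 0; hence \<open>card I\<close> is an
    admissible \<open>k\<close>.\<close>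
  have "I \<noteq> {}"
    using \<mu>(2) by auto
  then have "1 \<le> card I"
    using \<open>finite I\<close> by (simp add: Suc_le_eq card_gt_0_iff)
  moreover have "(\<Sum>j\<in>{1..card I}. \<mu> (h j)) = 1"
    using sum.reindex_bij_betw[OF h, of \<mu>] \<mu>(2) by simp
  moreover have "W (x, y) = (\<Sum>j\<in>{1..card I}. \<mu> (h j) *
      channel_comp X Y' Y (det_channel Y' Y (g (h j)))
        (channel_comp X X' Y' W' (det_channel X X' (f (h j)))) (x, y))" if "x \<in> X" "y \<in> Y" for x y
  proof -
    have "W (x, y) = (\<Sum>j\<in>{1..card I}. \<mu> (h j) *
        (\<Sum>y'\<in>Y'. of_bool (g (h j) y' = y) * W' (f (h j) x, y')))"
      using eq[OF that] sum.reindex_bij_betw[OF h, symmetric] by simp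
    then show ?thesis
      by (simp only: channel_comp_det_channel[OF fin(1) f[OF hI] that] cong: sum.cong)
  qed
  moreover have "det_channel X X' (f (h j)) \<in> DMC X X' \<and> det_channel Y' Y (g (h j)) \<in> DMC Y' Y"
    if "j \<in> {1..card I}" for j
    using that by (intro conjI det_channel_in_DMC fin f g hI)
  ultimately show ?thesis
    unfolding channel_contains_def
    using W \<mu>(1) hI
    by (intro conjI exI[of _ "card I"] exI[of _ "\<lambda>j. \<mu> (h j)"]
        exI[of _ "\<lambda>j. det_channel X X' (f (h j))"] exI[of _ "\<lambda>j. det_channel Y' Y (g (h j))"])
      auto
qed

text \<open>
  Choosing the values \<open>f a\<close> independently with laws \<open>R (a, \<cdot>)\<close> writes \<open>R\<close> as a mixture of
  deterministic channels.
\<close>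

lemma sum_PiE_DMC:
  assumes fin: "finite A" "finite B" and R: "R \<in> DMC A B"
  shows "(\<Sum>f\<in>A \<rightarrow>\<^sub>E B. \<Prod>a\<in>A. R (a, f a)) = 1"
    and "a0 \<in> A \<Longrightarrow> (\<Sum>f\<in>A \<rightarrow>\<^sub>E B. (\<Prod>a\<in>A. R (a, f a)) * \<phi> (f a0)) = (\<Sum>b\<in>B. R (a0, b) * \<phi> b)"
proof -
  show "(\<Sum>f\<in>A \<rightarrow>\<^sub>E B. \<Prod>a\<in>A. R (a, f a)) = 1"
    using R fin by (subst prod_sum_PiE[symmetric]) (simp_all add: DMC_sum)
  assume a0: "a0 \<in> A"
  \<comment> \<open>\<open>\<phi>\<close> is absorbed into the factor at \<open>a0\<close> alone, so
    that the sum over maps still factorises over the coordinates; every other factor is then a row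
    sum, equal to 1.\<close>
  let ?h = "\<lambda>a b. R (a, b) * (if a = a0 then \<phi> b else 1)"
  have "(\<Sum>f\<in>A \<rightarrow>\<^sub>E B. (\<Prod>a\<in>A. R (a, f a)) * \<phi> (f a0)) = (\<Sum>f\<in>A \<rightarrow>\<^sub>E B. \<Prod>a\<in>A. ?h a (f a))"
    using a0 fin by (simp add: prod.distrib prod.delta)
  also have "\<dots> = (\<Prod>a\<in>A. \<Sum>b\<in>B. ?h a b)"
    using fin by (simp add: prod_sum_PiE)
  also have "\<dots> = (\<Sum>b\<in>B. ?h a0 b) * (\<Prod>a\<in>A - {a0}. \<Sum>b\<in>B. ?h a b)"
    by (rule prod.remove[OF fin(1) a0])
  also have "(\<Prod>a\<in>A - {a0}. \<Sum>b\<in>B. ?h a b) = 1"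
    using R by (intro prod.neutral) (auto simp: DMC_sum)
  finally show "(\<Sum>f\<in>A \<rightarrow>\<^sub>E B. (\<Prod>a\<in>A. R (a, f a)) * \<phi> (f a0)) = (\<Sum>b\<in>B. R (a0, b) * \<phi> b)"
    by simp
qed

text \<open>Converse of \<open>channel_containsI\<close>, obtained by splitting every
  \<open>R i\<close> and \<open>T i\<close> into deterministic channels. In contrast to the numbers
  \<open>k\<close> in the definition, the index set is now finite and depends on the alphabets only;
  this is what makes compactness arguments possible.\<close>

lemma channel_containsE:
  assumes fin: "finite X" "finite X'" "finite Y" "finite Y'"
    and con: "channel_contains X' Y' W' X Y W"
  obtains \<mu> where "\<And>p. p \<in> (X \<rightarrow>\<^sub>E X') \<times> (Y' \<rightarrow>\<^sub>E Y) \<Longrightarrow> 0 \<le> \<mu> p"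
    and "(\<Sum>p\<in>(X \<rightarrow>\<^sub>E X') \<times> (Y' \<rightarrow>\<^sub>E Y). \<mu> p) = 1"
    and "\<And>x y. x \<in> X \<Longrightarrow> y \<in> Y \<Longrightarrow> W (x, y) = (\<Sum>p\<in>(X \<rightarrow>\<^sub>E X') \<times> (Y' \<rightarrow>\<^sub>E Y).
            \<mu> p * (\<Sum>y'\<in>Y'. of_bool (snd p y' = y) * W' (fst p x, y')))"
proof -
  from con obtain k :: nat and \<alpha> :: "nat \<Rightarrow> real" and R T where
    \<alpha>: "\<forall>i\<in>{1..k}. 0 \<le> \<alpha> i" "(\<Sum>i\<in>{1..k}. \<alpha> i) = 1"
    and RT: "\<forall>i\<in>{1..k}. R i \<in> DMC X X' \<and> T i \<in> DMC Y' Y"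
    and eq: "\<forall>x\<in>X. \<forall>y\<in>Y. W (x, y) = (\<Sum>i\<in>{1..k}. \<alpha> i *
              channel_comp X Y' Y (T i) (channel_comp X X' Y' W' (R i)) (x, y))"
    unfolding channel_contains_def by blast
  \<comment> \<open>\<open>r i\<close> and \<open>t i\<close> are the laws of random maps with
    independent values distributed as in \<open>R i\<close> and \<open>T i\<close>. Given
    \<open>i\<close>, the two maps are independent; averaging over \<open>i\<close> may correlate
    them, so the weights \<open>\<mu>\<close> have to live on pairs.\<close>
  define r where "r i f = (\<Prod>x\<in>X. R i (x, f x))" for i f
  define t where "t i g = (\<Prod>y'\<in>Y'. T i (y', g y'))" for i g
  define \<mu> where "\<mu> p = (\<Sum>i\<in>{1..k}. \<alpha> i * (r i (fst p) * t i (snd p)))" for p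
  let ?F = "X \<rightarrow>\<^sub>E X'" and ?G = "Y' \<rightarrow>\<^sub>E Y"
  have r: "(\<Sum>f\<in>?F. r i f) = 1"
      "x \<in> X \<Longrightarrow> (\<Sum>f\<in>?F. r i f * \<phi> (f x)) = (\<Sum>x'\<in>X'. R i (x, x') * \<phi> x')"
    if "i \<in> {1..k}" for i x \<phi>
    using sum_PiE_DMC[of X X' "R i"] fin RT that by (simp_all add: r_def)
  have t: "(\<Sum>g\<in>?G. t i g) = 1"
      "y' \<in> Y' \<Longrightarrow> (\<Sum>g\<in>?G. t i g * \<phi> (g y')) = (\<Sum>y\<in>Y. T i (y', y) * \<phi> y)"
    if "i \<in> {1..k}" for i y' \<phi>
    using sum_PiE_DMC[of Y' Y "T i"] fin RT that by (simp_all add: t_def)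
  \<comment> \<open>An average under \<open>\<mu>\<close> is computed by fixing \<open>i\<close>
    first, then \<open>f\<close>, then \<open>g\<close>.\<close>
  have mix: "(\<Sum>p\<in>?F \<times> ?G. \<mu> p * \<phi> (fst p) (snd p)) =
      (\<Sum>i\<in>{1..k}. \<alpha> i * (\<Sum>f\<in>?F. r i f * (\<Sum>g\<in>?G. t i g * \<phi> f g)))" for \<phi>
  proof -
    have "(\<Sum>p\<in>?F \<times> ?G. \<mu> p * \<phi> (fst p) (snd p)) =
        (\<Sum>i\<in>{1..k}. \<Sum>p\<in>?F \<times> ?G. \<alpha> i * (r i (fst p) * t i (snd p)) * \<phi> (fst p) (snd p))"
      unfolding \<mu>_def sum_distrib_right by (rule sum.swap)
    also have "\<dots> = (\<Sum>i\<in>{1..k}. \<alpha> i * (\<Sum>f\<in>?F. r i f * (\<Sum>g\<in>?G. t i g * \<phi> f g)))"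
      by (simp add: sum.cartesian_product' sum_distrib_left mult_ac)
    finally show ?thesis .
  qed
  show ?thesis
  proof
    show "0 \<le> \<mu> p" if "p \<in> ?F \<times> ?G" for p
      using that \<alpha>(1) RT unfolding \<mu>_def r_def t_def
      by (intro sum_nonneg mult_nonneg_nonneg prod_nonneg)
        (auto intro!: DMC_nonneg)
    show "(\<Sum>p\<in>?F \<times> ?G. \<mu> p) = 1"
      using mix[of "\<lambda>_ _. 1"] r(1) t(1) \<alpha>(2) by simp
    show "W (x, y) = (\<Sum>p\<in>?F \<times> ?G. \<mu> p * (\<Sum>y'\<in>Y'. of_bool (snd p y' = y) * W' (fst p x, y')))"
      if xy: "x \<in> X" "y \<in> Y" for x y
    proof -
      have "channel_comp X Y' Y (T i) (channel_comp X X' Y' W' (R i)) (x, y) =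
          (\<Sum>f\<in>?F. r i f * (\<Sum>g\<in>?G. t i g * (\<Sum>y'\<in>Y'. of_bool (g y' = y) * W' (f x, y'))))"
        if i: "i \<in> {1..k}" for i
      proof -
        \<comment> \<open>The probability that the random \<open>g\<close> sends \<open>y'\<close>
          to \<open>y\<close> is \<open>T i (y', y)\<close>.\<close>
        have "(\<Sum>g\<in>?G. t i g * (\<Sum>y'\<in>Y'. of_bool (g y' = y) * w y')) =
            (\<Sum>y'\<in>Y'. T i (y', y) * w y')" for w :: "_ \<Rightarrow> real"
        proof -
          have "(\<Sum>g\<in>?G. t i g * (\<Sum>y'\<in>Y'. of_bool (g y' = y) * w y')) =
              (\<Sum>y'\<in>Y'. (\<Sum>g\<in>?G. t i g * of_bool (y = g y')) * w y')"
            by (simp add: sum_distrib_left sum_distrib_right sum.swap[of _ Y'] mult_ac eq_commute)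
          then show ?thesis
            using t(2)[OF i, of _ "\<lambda>v. of_bool (y = v)"] xy(2) fin(3)
            by (simp add: sum_of_bool_delta)
        qed
        then have "(\<Sum>f\<in>?F. r i f * (\<Sum>g\<in>?G. t i g * (\<Sum>y'\<in>Y'. of_bool (g y' = y) * W' (f x, y')))) =
            (\<Sum>x'\<in>X'. R i (x, x') * (\<Sum>y'\<in>Y'. T i (y', y) * W' (x', y')))"
          using r(2)[OF i xy(1), of "\<lambda>x'. \<Sum>y'\<in>Y'. T i (y', y) * W' (x', y')"] by simp
        also have "\<dots> = channel_comp X Y' Y (T i) (channel_comp X X' Y' W' (R i)) (x, y)"
          using xy by (simp add: channel_comp_def sum_distrib_left sum.swap[of _ X'] mult_ac)
        finally show ?thesis by simp
      qed
      then show ?thesis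
        using eq xy mix[of "\<lambda>f g. \<Sum>y'\<in>Y'. of_bool (g y' = y) * W' (f x, y')"] by simp
    qed
  qed
qed

text \<open>A single pair of maps with weight 1 suffices: inputs are relabelled by \<open>e\<close>,
  outputs by the inverse of \<open>d\<close>, because output maps run from \<open>Y'\<close> to
  \<open>Y\<close>.\<close>

lemma channel_contains_bij_betw:
  assumes fin: "finite X'" "finite Y'" "finite Y"
    and W: "W' \<in> DMC X' Y'" "W \<in> DMC X Y"
    and e: "bij_betw e X X'" and d: "bij_betw d Y Y'"
    and eq: "\<And>x y. x \<in> X \<Longrightarrow> y \<in> Y \<Longrightarrow> W (x, y) = W' (e x, d y)"
  shows "channel_contains X' Y' W' X Y W"
proof (rule channel_containsI[where I = "{()}" and \<mu> = "\<lambda>_. 1"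
      and f = "\<lambda>_. e" and g = "\<lambda>_. inv_into Y d"])
  fix x y
  assume xy: "x \<in> X" "y \<in> Y"
  have "of_bool (inv_into Y d y' = y) = (of_bool (d y = y') :: real)" if "y' \<in> Y'" for y'
    using d that xy(2) bij_betw_inv_into_left[OF d] bij_betw_inv_into_right[OF d]
    by (auto simp: of_bool_def)
  then have "(\<Sum>y'\<in>Y'. of_bool (inv_into Y d y' = y) * W' (e x, y')) = W' (e x, d y)"
    using bij_betwE[OF d] xy(2) fin(2) by (simp add: sum_of_bool_delta cong: sum.cong)
  then show "W (x, y) = (\<Sum>i\<in>{()}. 1 * (\<Sum>y'\<in>Y'. of_bool (inv_into Y d y' = y) * W' (e x, y')))"
    using eq[OF xy] by simp
qed (use assms bij_betwE[OF e] bij_betwE[OF bij_betw_inv_into[OF d]] in auto)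

section \<open>Containment as a preorder and the induced equivalence relations\<close>

lemma channel_contains_refl:
  "finite X \<Longrightarrow> finite Y \<Longrightarrow> W \<in> DMC X Y \<Longrightarrow> channel_contains X Y W X Y W"
  using channel_contains_bij_betw[of X Y Y W W X id id] by simp

text \<open>Two mixtures are composed by drawing \<open>p\<close> and \<open>q\<close>
  independently: weights multiply, input maps compose along \<open>X\<close>, \<open>X'\<close>,
  \<open>X''\<close> and output maps along \<open>Y''\<close>, \<open>Y'\<close>,
  \<open>Y\<close>.\<close>

lemma channel_contains_trans:
  assumes fin: "finite X" "finite Y" "finite X'" "finite Y'" "finite X''" "finite Y''"
    and 1: "channel_contains X'' Y'' W'' X' Y' W'" and 2: "channel_contains X' Y' W' X Y W"
  shows "channel_contains X'' Y'' W'' X Y W"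
proof -
  define P where "P = (X \<rightarrow>\<^sub>E X') \<times> (Y' \<rightarrow>\<^sub>E Y)"
  define Q where "Q = (X' \<rightarrow>\<^sub>E X'') \<times> (Y'' \<rightarrow>\<^sub>E Y')"
  obtain \<mu>
    where \<mu>: "\<And>p. p \<in> P \<Longrightarrow> 0 \<le> \<mu> p" "(\<Sum>p\<in>P. \<mu> p) = 1"
      and W: "\<And>x y. x \<in> X \<Longrightarrow> y \<in> Y \<Longrightarrow>
        W (x, y) = (\<Sum>p\<in>P. \<mu> p * (\<Sum>y'\<in>Y'. of_bool (snd p y' = y) * W' (fst p x, y')))"
    by (rule channel_containsE[OF fin(1,3,2,4) 2, folded P_def]) (use that in blast)
  obtain \<nu>
    where \<nu>: "\<And>q. q \<in> Q \<Longrightarrow> 0 \<le> \<nu> q" "(\<Sum>q\<in>Q. \<nu> q) = 1"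
      and W': "\<And>x y. x \<in> X' \<Longrightarrow> y \<in> Y' \<Longrightarrow>
        W' (x, y) = (\<Sum>q\<in>Q. \<nu> q * (\<Sum>y'\<in>Y''. of_bool (snd q y' = y) * W'' (fst q x, y')))"
    by (rule channel_containsE[OF fin(3,5,4,6) 1, folded Q_def]) (use that in blast)
  have PD: "fst p x \<in> X'" if "p \<in> P" "x \<in> X" for p x
    using that by (auto simp: P_def)
  have QD: "snd q y \<in> Y'" if "q \<in> Q" "y \<in> Y''" for q y
    using that by (auto simp: Q_def)
  show ?thesis
  proof (rule channel_containsI[where I = "P \<times> Q" and \<mu> = "\<lambda>(p, q). \<mu> p * \<nu> q"
        and f = "\<lambda>(p, q). fst q \<circ> fst p" and g = "\<lambda>(p, q). snd p \<circ> snd q"])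
    show "finite (P \<times> Q)"
      using fin by (simp add: P_def Q_def finite_PiE)
    show "(\<Sum>i\<in>P \<times> Q. case i of (p, q) \<Rightarrow> \<mu> p * \<nu> q) = 1"
      using \<mu>(2) \<nu>(2) by (simp flip: sum.cartesian_product sum_product)
    fix x y
    assume xy: "x \<in> X" "y \<in> Y"
    have "(\<Sum>y'\<in>Y'. of_bool (snd p y' = y) * W' (fst p x, y')) =
        (\<Sum>q\<in>Q. \<nu> q * (\<Sum>y''\<in>Y''. of_bool (snd p (snd q y'') = y) * W'' (fst q (fst p x), y'')))"
      if p: "p \<in> P" for p
    proof -
      have "(\<Sum>y'\<in>Y'. of_bool (snd p y' = y) * W' (fst p x, y')) =
          (\<Sum>y'\<in>Y'. \<Sum>q\<in>Q. \<Sum>y''\<in>Y''. \<nu> q * W'' (fst q (fst p x), y'') *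
             (of_bool (snd q y'' = y') * of_bool (snd p y' = y)))"
        using W'[OF PD[OF p xy(1)]] by (simp add: sum_distrib_left mult_ac)
      also have "\<dots> = (\<Sum>q\<in>Q. \<Sum>y''\<in>Y''. \<Sum>y'\<in>Y'. \<nu> q * W'' (fst q (fst p x), y'') *
             (of_bool (snd q y'' = y') * of_bool (snd p y' = y)))"
        by (subst sum.swap, rule sum.cong[OF refl], rule sum.swap)
      \<comment> \<open>The sum over the intermediate output collapses to its only possible value
        \<open>snd q y''\<close>, which lies in \<open>Y'\<close>.\<close>
      also have "\<dots> = (\<Sum>q\<in>Q. \<Sum>y''\<in>Y''. \<nu> q * W'' (fst q (fst p x), y'') *
             of_bool (snd p (snd q y'') = y))"
        by (intro sum.cong refl)
          (simp only: sum_of_bool_delta(1)[OF fin(4)] QD if_True flip: sum_distrib_left)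
      finally show ?thesis
        by (simp add: sum_distrib_left mult_ac)
    qed
    then have "W (x, y) = (\<Sum>p\<in>P. \<mu> p * (\<Sum>q\<in>Q. \<nu> q *
        (\<Sum>y''\<in>Y''. of_bool (snd p (snd q y'') = y) * W'' (fst q (fst p x), y''))))"
      using W[OF xy] by simp
    then show "W (x, y) = (\<Sum>i\<in>P \<times> Q. (case i of (p, q) \<Rightarrow> \<mu> p * \<nu> q) *
        (\<Sum>y''\<in>Y''. of_bool ((case i of (p, q) \<Rightarrow> snd p \<circ> snd q) y'' = y) *
          W'' ((case i of (p, q) \<Rightarrow> fst q \<circ> fst p) x, y'')))"
      by (simp add: sum.cartesian_product' sum_distrib_left mult_ac)
  qed (use fin 1 2 \<mu>(1) \<nu>(1) in \<open>auto simp: channel_contains_def P_def Q_def\<close>)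
qed

lemma shannon_equiv_sym: "shannon_equiv X' Y' W' X Y W \<Longrightarrow> shannon_equiv X Y W X' Y' W'"
  by (simp add: shannon_equiv_def)

lemma shannon_equiv_trans:
  assumes "finite X" "finite Y" "finite X'" "finite Y'" "finite X''" "finite Y''"
    and "shannon_equiv X'' Y'' W'' X' Y' W'" "shannon_equiv X' Y' W' X Y W"
  shows "shannon_equiv X'' Y'' W'' X Y W"
  using assms unfolding shannon_equiv_def
  by (blast intro: channel_contains_trans)

text \<open>The inverse bijections give the second containment. This justifies passing from
  arbitrary finite alphabets to the alphabets \<open>{1..n}\<close>.\<close>

lemma shannon_equiv_bij_betw:
  assumes "finite X" "finite Y" "finite X'" "finite Y'"
    and "W' \<in> DMC X' Y'" "W \<in> DMC X Y"
    and e: "bij_betw e X X'" and d: "bij_betw d Y Y'"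
    and eq: "\<And>x y. x \<in> X \<Longrightarrow> y \<in> Y \<Longrightarrow> W (x, y) = W' (e x, d y)"
  shows "shannon_equiv X' Y' W' X Y W"
  unfolding shannon_equiv_def
proof
  show "channel_contains X' Y' W' X Y W"
    using assms by (intro channel_contains_bij_betw)
  have "W' (x, y) = W (inv_into X e x, inv_into Y d y)" if "x \<in> X'" "y \<in> Y'" for x y
    using that e d bij_betwE[OF bij_betw_inv_into[OF e]] bij_betwE[OF bij_betw_inv_into[OF d]]
    by (simp add: eq bij_betw_inv_into_right)
  then show "channel_contains X Y W X' Y' W'"
    using assms by (intro channel_contains_bij_betw[OF _ _ _ _ _ bij_betw_inv_into[OF e] bij_betw_inv_into[OF d]])
qed

lemma equiv_shannon_rel:
  assumes "finite X" "finite Y"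
  shows "equiv (DMC X Y) (shannon_rel X Y)"
proof (intro equivI refl_onI symI transI)
  show "shannon_rel X Y \<subseteq> DMC X Y \<times> DMC X Y"
    by (auto simp: shannon_rel_def shannon_equiv_def channel_contains_def)
qed (use assms shannon_equiv_sym shannon_equiv_trans in
    \<open>auto simp: shannon_rel_def shannon_equiv_def channel_contains_refl intro: channel_contains_trans\<close>)

lemma equiv_shannon_rel_star: "equiv DMC_star shannon_rel_star"
proof (intro equivI refl_onI symI transI)
  show "shannon_rel_star \<subseteq> DMC_star \<times> DMC_star"
    by (auto simp: shannon_rel_star_def)
  show "(p, p) \<in> shannon_rel_star" if "p \<in> DMC_star" for p
    using that
    by (auto simp: shannon_rel_star_def shannon_equiv_def DMC_star_def intro!: channel_contains_refl)
  show "(q, p) \<in> shannon_rel_star" if "(p, q) \<in> shannon_rel_star" for p q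
    using that by (auto simp: shannon_rel_star_def intro: shannon_equiv_sym)
  show "(p, r) \<in> shannon_rel_star" if "(p, q) \<in> shannon_rel_star" "(q, r) \<in> shannon_rel_star" for p q r
    using that by (auto simp: shannon_rel_star_def intro: shannon_equiv_trans[rotated 6])
qed

section \<open>Sums and products of channels\<close>

lemma channel_sum_simps [simp]:
  "x \<in> X1 \<Longrightarrow> y \<in> Y1 \<Longrightarrow> channel_sum X1 Y1 X2 Y2 W1 W2 (Inl x, Inl y) = W1 (x, y)"
  "x \<in> X1 \<Longrightarrow> z \<in> Y2 \<Longrightarrow> channel_sum X1 Y1 X2 Y2 W1 W2 (Inl x, Inr z) = 0"
  "u \<in> X2 \<Longrightarrow> y \<in> Y1 \<Longrightarrow> channel_sum X1 Y1 X2 Y2 W1 W2 (Inr u, Inl y) = 0"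
  "u \<in> X2 \<Longrightarrow> z \<in> Y2 \<Longrightarrow> channel_sum X1 Y1 X2 Y2 W1 W2 (Inr u, Inr z) = W2 (u, z)"
  by (auto simp: channel_sum_def)

lemma channel_prod_simps [simp]:
  "x \<in> X1 \<Longrightarrow> u \<in> X2 \<Longrightarrow> y \<in> Y1 \<Longrightarrow> z \<in> Y2 \<Longrightarrow>
    channel_prod X1 Y1 X2 Y2 W1 W2 ((x, u), (y, z)) = W1 (x, y) * W2 (u, z)"
  by (auto simp: channel_prod_def)

lemma channel_sum_in_DMC:
  assumes "finite Y1" "finite Y2" "W1 \<in> DMC X1 Y1" "W2 \<in> DMC X2 Y2"
  shows "channel_sum X1 Y1 X2 Y2 W1 W2 \<in> DMC (X1 <+> X2) (Y1 <+> Y2)"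
proof -
  have "(\<Sum>y\<in>Y1 <+> Y2. channel_sum X1 Y1 X2 Y2 W1 W2 (x, y)) = 1" if "x \<in> X1 <+> X2" for x
    using assms that by (auto simp: sum.Plus DMC_sum)
  then show ?thesis
    unfolding DMC_def using assms
    by (auto simp: DMC_nonneg) (simp add: channel_sum_def)
qed

lemma channel_prod_in_DMC:
  assumes "W1 \<in> DMC X1 Y1" "W2 \<in> DMC X2 Y2"
  shows "channel_prod X1 Y1 X2 Y2 W1 W2 \<in> DMC (X1 \<times> X2) (Y1 \<times> Y2)"
proof -
  have "(\<Sum>y\<in>Y1 \<times> Y2. channel_prod X1 Y1 X2 Y2 W1 W2 (x, y)) = 1" if "x \<in> X1 \<times> X2" for x
    using assms that
    by (auto simp: sum.cartesian_product' DMC_sum simp flip: sum_product)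
  then show ?thesis
    unfolding DMC_def using assms
    by (auto simp: DMC_nonneg) (simp add: channel_prod_def)
qed

text \<open>Independently drawn pairs \<open>p\<close> and \<open>q\<close> act side by side through
  \<open>map_sum\<close>. A diagonal block of the sum sees only one of the two, and the weights of
  the other add up to 1.\<close>

lemma channel_contains_sum:
  assumes fin: "finite X1" "finite Y1" "finite X1'" "finite Y1'"
      "finite X2" "finite Y2" "finite X2'" "finite Y2'"
    and 1: "channel_contains X1' Y1' W1' X1 Y1 W1" and 2: "channel_contains X2' Y2' W2' X2 Y2 W2"
  shows "channel_contains (X1' <+> X2') (Y1' <+> Y2') (channel_sum X1' Y1' X2' Y2' W1' W2')
     (X1 <+> X2) (Y1 <+> Y2) (channel_sum X1 Y1 X2 Y2 W1 W2)"
proof -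
  define P where "P = (X1 \<rightarrow>\<^sub>E X1') \<times> (Y1' \<rightarrow>\<^sub>E Y1)"
  define Q where "Q = (X2 \<rightarrow>\<^sub>E X2') \<times> (Y2' \<rightarrow>\<^sub>E Y2)"
  obtain \<mu>
    where \<mu>: "\<And>p. p \<in> P \<Longrightarrow> 0 \<le> \<mu> p" "(\<Sum>p\<in>P. \<mu> p) = 1"
      and W1: "\<And>x y. x \<in> X1 \<Longrightarrow> y \<in> Y1 \<Longrightarrow>
        W1 (x, y) = (\<Sum>p\<in>P. \<mu> p * (\<Sum>y'\<in>Y1'. of_bool (snd p y' = y) * W1' (fst p x, y')))"
    by (rule channel_containsE[OF fin(1,3,2,4) 1, folded P_def]) (use that in blast)
  obtain \<nu>
    where \<nu>: "\<And>q. q \<in> Q \<Longrightarrow> 0 \<le> \<nu> q" "(\<Sum>q\<in>Q. \<nu> q) = 1"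
      and W2: "\<And>x y. x \<in> X2 \<Longrightarrow> y \<in> Y2 \<Longrightarrow>
        W2 (x, y) = (\<Sum>q\<in>Q. \<nu> q * (\<Sum>y'\<in>Y2'. of_bool (snd q y' = y) * W2' (fst q x, y')))"
    by (rule channel_containsE[OF fin(5,7,6,8) 2, folded Q_def]) (use that in blast)
  have PD: "fst p x \<in> X1'" if "p \<in> P" "x \<in> X1" for p x
    using that by (auto simp: P_def)
  have QD: "fst q x \<in> X2'" if "q \<in> Q" "x \<in> X2" for q x
    using that by (auto simp: Q_def)
  \<comment> \<open>The marginals of the product weights are \<open>\<mu>\<close> and
    \<open>\<nu>\<close>.\<close>
  have mix: "(\<Sum>i\<in>P \<times> Q. (case i of (p, q) \<Rightarrow> \<mu> p * \<nu> q) * a (fst i)) = (\<Sum>p\<in>P. \<mu> p * a p)"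
      "(\<Sum>i\<in>P \<times> Q. (case i of (p, q) \<Rightarrow> \<mu> p * \<nu> q) * b (snd i)) = (\<Sum>q\<in>Q. \<nu> q * b q)" for a b
  proof -
    have "(\<Sum>i\<in>P \<times> Q. (case i of (p, q) \<Rightarrow> \<mu> p * \<nu> q) * a (fst i)) =
        (\<Sum>p\<in>P. \<mu> p * a p) * (\<Sum>q\<in>Q. \<nu> q)"
      unfolding sum_product sum.cartesian_product by (intro sum.cong refl) (auto simp: mult_ac)
    then show "(\<Sum>i\<in>P \<times> Q. (case i of (p, q) \<Rightarrow> \<mu> p * \<nu> q) * a (fst i)) = (\<Sum>p\<in>P. \<mu> p * a p)"
      by (simp add: \<nu>(2))
    have "(\<Sum>i\<in>P \<times> Q. (case i of (p, q) \<Rightarrow> \<mu> p * \<nu> q) * b (snd i)) =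
        (\<Sum>p\<in>P. \<mu> p) * (\<Sum>q\<in>Q. \<nu> q * b q)"
      unfolding sum_product sum.cartesian_product by (intro sum.cong refl) (auto simp: mult_ac)
    then show "(\<Sum>i\<in>P \<times> Q. (case i of (p, q) \<Rightarrow> \<mu> p * \<nu> q) * b (snd i)) = (\<Sum>q\<in>Q. \<nu> q * b q)"
      by (simp add: \<mu>(2))
  qed
  let ?f = "\<lambda>i. map_sum (fst (fst i)) (fst (snd i))"
  let ?g = "\<lambda>i. map_sum (snd (fst i)) (snd (snd i))"
  let ?W = "channel_sum X1 Y1 X2 Y2 W1 W2" and ?W' = "channel_sum X1' Y1' X2' Y2' W1' W2'"
  show ?thesis
  proof (rule channel_containsI[where I = "P \<times> Q" and \<mu> = "\<lambda>(p, q). \<mu> p * \<nu> q"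
        and f = ?f and g = ?g])
    show "finite (P \<times> Q)"
      using fin by (simp add: P_def Q_def finite_PiE)
    show "(\<Sum>i\<in>P \<times> Q. case i of (p, q) \<Rightarrow> \<mu> p * \<nu> q) = 1"
      using \<mu>(2) \<nu>(2) by (simp flip: sum.cartesian_product sum_product)
    fix x y
    assume "x \<in> X1 <+> X2" "y \<in> Y1 <+> Y2"
    then show "?W (x, y) = (\<Sum>i\<in>P \<times> Q. (case i of (p, q) \<Rightarrow> \<mu> p * \<nu> q) *
        (\<Sum>y'\<in>Y1' <+> Y2'. of_bool (?g i y' = y) * ?W' (?f i x, y')))"
    proof (elim PlusE)
      fix x1 y1
      assume xy: "x1 \<in> X1" "y1 \<in> Y1" "x = Inl x1" "y = Inl y1"
      have "(\<Sum>y'\<in>Y1' <+> Y2'. of_bool (?g i y' = y) * ?W' (?f i x, y')) =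
          (\<Sum>y'\<in>Y1'. of_bool (snd (fst i) y' = y1) * W1' (fst (fst i) x1, y'))"
        if "i \<in> P \<times> Q" for i
        using that xy fin PD by (auto simp: sum.Plus simp del: sum_of_bool_mult_eq)
      then show ?thesis
        using mix(1)[of "\<lambda>p. \<Sum>y'\<in>Y1'. of_bool (snd p y' = y1) * W1' (fst p x1, y')"] W1 xy
        by simp
    next
      fix x2 y2
      assume xy: "x2 \<in> X2" "y2 \<in> Y2" "x = Inr x2" "y = Inr y2"
      have "(\<Sum>y'\<in>Y1' <+> Y2'. of_bool (?g i y' = y) * ?W' (?f i x, y')) =
          (\<Sum>y'\<in>Y2'. of_bool (snd (snd i) y' = y2) * W2' (fst (snd i) x2, y'))"
        if "i \<in> P \<times> Q" for i
        using that xy fin QD by (auto simp: sum.Plus simp del: sum_of_bool_mult_eq)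
      then show ?thesis
        using mix(2)[of "\<lambda>q. \<Sum>y'\<in>Y2'. of_bool (snd q y' = y2) * W2' (fst q x2, y')"] W2 xy
        by simp
    \<comment> \<open>In the two off-diagonal cases both sides vanish: \<open>map_sum\<close> keeps
      the summands apart and \<open>?W'\<close> has no transitions between them.\<close>
    qed (use fin PD QD in \<open>auto simp: sum.Plus simp del: sum_of_bool_mult_eq intro!: sum.neutral\<close>)
  qed (use fin 1 2 \<mu>(1) \<nu>(1) in
      \<open>auto simp: channel_contains_def P_def Q_def intro!: channel_sum_in_DMC\<close>)
qed

text \<open>With \<open>p\<close> and \<open>q\<close> drawn independently and acting through
  \<open>map_prod\<close>, the sum over outputs factorises into \<open>a p * b q\<close>, and the
  sum over the weights then factorises as well.\<close>

lemma channel_contains_prod: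
  assumes fin: "finite X1" "finite Y1" "finite X1'" "finite Y1'"
      "finite X2" "finite Y2" "finite X2'" "finite Y2'"
    and 1: "channel_contains X1' Y1' W1' X1 Y1 W1" and 2: "channel_contains X2' Y2' W2' X2 Y2 W2"
  shows "channel_contains (X1' \<times> X2') (Y1' \<times> Y2') (channel_prod X1' Y1' X2' Y2' W1' W2')
     (X1 \<times> X2) (Y1 \<times> Y2) (channel_prod X1 Y1 X2 Y2 W1 W2)"
proof -
  define P where "P = (X1 \<rightarrow>\<^sub>E X1') \<times> (Y1' \<rightarrow>\<^sub>E Y1)"
  define Q where "Q = (X2 \<rightarrow>\<^sub>E X2') \<times> (Y2' \<rightarrow>\<^sub>E Y2)"
  obtain \<mu>
    where \<mu>: "\<And>p. p \<in> P \<Longrightarrow> 0 \<le> \<mu> p" "(\<Sum>p\<in>P. \<mu> p) = 1"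
      and W1: "\<And>x y. x \<in> X1 \<Longrightarrow> y \<in> Y1 \<Longrightarrow>
        W1 (x, y) = (\<Sum>p\<in>P. \<mu> p * (\<Sum>y'\<in>Y1'. of_bool (snd p y' = y) * W1' (fst p x, y')))"
    by (rule channel_containsE[OF fin(1,3,2,4) 1, folded P_def]) (use that in blast)
  obtain \<nu>
    where \<nu>: "\<And>q. q \<in> Q \<Longrightarrow> 0 \<le> \<nu> q" "(\<Sum>q\<in>Q. \<nu> q) = 1"
      and W2: "\<And>x y. x \<in> X2 \<Longrightarrow> y \<in> Y2 \<Longrightarrow>
        W2 (x, y) = (\<Sum>q\<in>Q. \<nu> q * (\<Sum>y'\<in>Y2'. of_bool (snd q y' = y) * W2' (fst q x, y')))"
    by (rule channel_containsE[OF fin(5,7,6,8) 2, folded Q_def]) (use that in blast)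
  have PD: "fst p x \<in> X1'" if "p \<in> P" "x \<in> X1" for p x
    using that by (auto simp: P_def)
  have QD: "fst q x \<in> X2'" if "q \<in> Q" "x \<in> X2" for q x
    using that by (auto simp: Q_def)
  let ?f = "\<lambda>i. map_prod (fst (fst i)) (fst (snd i))"
  let ?g = "\<lambda>i. map_prod (snd (fst i)) (snd (snd i))"
  let ?W = "channel_prod X1 Y1 X2 Y2 W1 W2" and ?W' = "channel_prod X1' Y1' X2' Y2' W1' W2'"
  show ?thesis
  proof (rule channel_containsI[where I = "P \<times> Q" and \<mu> = "\<lambda>(p, q). \<mu> p * \<nu> q"
        and f = ?f and g = ?g])
    show "finite (P \<times> Q)"
      using fin by (simp add: P_def Q_def finite_PiE)
    show "(\<Sum>i\<in>P \<times> Q. case i of (p, q) \<Rightarrow> \<mu> p * \<nu> q) = 1"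
      using \<mu>(2) \<nu>(2) by (simp flip: sum.cartesian_product sum_product)
    fix x y
    assume "x \<in> X1 \<times> X2" "y \<in> Y1 \<times> Y2"
    then obtain x1 x2 y1 y2 where xy: "x1 \<in> X1" "x2 \<in> X2" "y1 \<in> Y1" "y2 \<in> Y2"
        "x = (x1, x2)" "y = (y1, y2)"
      by blast
    define a where "a p = (\<Sum>y'\<in>Y1'. of_bool (snd p y' = y1) * W1' (fst p x1, y'))" for p
    define b where "b q = (\<Sum>y'\<in>Y2'. of_bool (snd q y' = y2) * W2' (fst q x2, y'))" for q
    have "(\<Sum>y'\<in>Y1' \<times> Y2'. of_bool (?g (p, q) y' = y) * ?W' (?f (p, q) x, y')) = a p * b q"
      if "p \<in> P" "q \<in> Q" for p q
      using that xy PD QD unfolding a_def b_def sum_product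
      by (simp add: sum.cartesian_product' of_bool_conj mult_ac)
    then have "(\<Sum>i\<in>P \<times> Q. (case i of (p, q) \<Rightarrow> \<mu> p * \<nu> q) *
        (\<Sum>y'\<in>Y1' \<times> Y2'. of_bool (?g i y' = y) * ?W' (?f i x, y'))) =
        (\<Sum>(p, q)\<in>P \<times> Q. (\<mu> p * a p) * (\<nu> q * b q))"
      by (intro sum.cong) auto
    also have "\<dots> = (\<Sum>p\<in>P. \<mu> p * a p) * (\<Sum>q\<in>Q. \<nu> q * b q)"
      by (simp add: sum_product sum.cartesian_product)
    also have "\<dots> = ?W (x, y)"
      using xy W1 W2 by (simp add: a_def b_def)
    finally show "?W (x, y) = (\<Sum>i\<in>P \<times> Q. (case i of (p, q) \<Rightarrow> \<mu> p * \<nu> q) *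
        (\<Sum>y'\<in>Y1' \<times> Y2'. of_bool (?g i y' = y) * ?W' (?f i x, y')))" ..
  qed (use fin 1 2 \<mu>(1) \<nu>(1) in
      \<open>auto simp: channel_contains_def P_def Q_def intro!: channel_prod_in_DMC\<close>)
qed

section \<open>Compact Hausdorff quotients\<close>

text \<open>The saturation of a closed set \<open>C\<close> is the second projection of the part of
  \<open>r\<close> lying over \<open>C\<close>. That part is closed, and projecting along a compact
  factor is a closed map.\<close>

lemma closed_map_quotient_topology:
  assumes r: "equiv (topspace T) r" and T: "compact_space T" "closedin (prod_topology T T) r"
  shows "closed_map T (quotient_topology T r) (\<lambda>x. r `` {x})"
  unfolding closed_map_def
proof (intro allI impI)
  fix C
  assume C: "closedin T C"
  have CT: "C \<subseteq> topspace T"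
    using C closedin_subset by blast
  have "x \<in> topspace T \<and> r `` {x} = r `` {c} \<longleftrightarrow> (c, x) \<in> r" if "c \<in> C" for c x
    using equiv_class_eq_iff[OF r, of c x] CT that by auto
  then have "{x \<in> topspace T. r `` {x} \<in> (\<lambda>x. r `` {x}) ` C} = {x \<in> topspace T. \<exists>c\<in>C. (c, x) \<in> r}"
    by blast
  also have "\<dots> = snd ` (r \<inter> C \<times> topspace T)"
    by force
  finally have "{x \<in> topspace T. r `` {x} \<in> (\<lambda>x. r `` {x}) ` C} = snd ` (r \<inter> C \<times> topspace T)" .
  moreover have "closedin T (snd ` (r \<inter> C \<times> topspace T))"
    using Abstract_Topological_Spaces.closed_map_snd[OF T(1), of T] T(2) C
    by (simp add: closed_map_def closedin_Int closedin_prod_Times_iff)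
  ultimately have "closedin T {x \<in> topspace T. r `` {x} \<in> (\<lambda>x. r `` {x}) ` C}"
    by simp
  moreover have "(\<lambda>x. r `` {x}) ` C \<subseteq> topspace (quotient_topology T r)"
    using CT by (auto intro: quotientI)
  ultimately show "closedin (quotient_topology T r) ((\<lambda>x. r `` {x}) ` C)"
    using quotient_map_quotient_topology[of T r] unfolding quotient_map_closedin by metis
qed

text \<open>A compact Hausdorff space is normal, and normality survives continuous closed
  surjections. Points of the quotient are images of closed points, hence closed; normal and T1
  together give Hausdorff.\<close>

lemma Hausdorff_space_quotient_topology:
  assumes r: "equiv (topspace T) r" and T: "compact_space T" "closedin (prod_topology T T) r"
    and "Hausdorff_space T"
  shows "Hausdorff_space (quotient_topology T r)"
proof (rule normal_t1_imp_Hausdorff_space)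
  note cl = closed_map_quotient_topology[OF r T]
  show "normal_space (quotient_topology T r)"
    using quotient_map_quotient_topology[of T r] cl assms
    by (intro normal_space_continuous_closed_map_image[OF _ _ cl])
      (auto simp: compact_Hausdorff_or_regular_imp_normal_space quotient_imp_continuous_map
        quotient_imp_surjective_map simp del: topspace_quotient_topology)
  have "closedin (quotient_topology T r) ((\<lambda>x. r `` {x}) ` {x})" if "x \<in> topspace T" for x
    using cl that \<open>Hausdorff_space T\<close>
    unfolding closed_map_def by (meson closedin_Hausdorff_singleton)
  then show "t1_space (quotient_topology T r)"
    by (auto simp: t1_space_closedin_singleton quotient_def)
qed

text \<open>Points with the same tag are separated inside their component, points with different
  tags by the components themselves, which are open and disjoint.\<close>

lemma Hausdorff_space_sum_topology:
  assumes "\<And>i. i \<in> I \<Longrightarrow> Hausdorff_space (X i)"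
  shows "Hausdorff_space (sum_topology X I)"
  unfolding Hausdorff_space_def
proof (intro allI impI, elim conjE)
  fix p q
  assume pq: "p \<in> topspace (sum_topology X I)" "q \<in> topspace (sum_topology X I)" "p \<noteq> q"
  obtain i x where p: "p = (i, x)" "i \<in> I" "x \<in> topspace (X i)"
    using pq(1) by auto
  obtain j y where q: "q = (j, y)" "j \<in> I" "y \<in> topspace (X j)"
    using pq(2) by auto
  have op: "openin (sum_topology X I) (Pair i ` U)" if "i \<in> I" "openin (X i) U" for i U
    using open_map_component_injection[OF that(1), of X] that(2) by (simp add: open_map_def)
  show "\<exists>U V. openin (sum_topology X I) U \<and> openin (sum_topology X I) V \<and> p \<in> U \<and> q \<in> V \<and> disjnt U V"
  proof (cases "i = j")
    case True
    then obtain U V where UV: "openin (X i) U" "openin (X i) V" "x \<in> U" "y \<in> V" "disjnt U V"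
      using assms[OF p(2)] p q pq(3) unfolding Hausdorff_space_def by blast
    then have "disjnt (Pair i ` U) (Pair i ` V)"
      by (auto simp: disjnt_iff)
    then show ?thesis
      using op[OF p(2)] UV p(1) q(1) True by blast
  next
    case False
    then have "disjnt (Pair i ` topspace (X i)) (Pair j ` topspace (X j))"
      by (auto simp: disjnt_iff)
    then show ?thesis
      using op[OF p(2) openin_topspace] op[OF q(2) openin_topspace] p q by blast
  qed
qed

section \<open>Topology of the channels with fixed alphabets\<close>

lemma continuous_map_DMC_component:
  assumes "continuous_map T (DMC_topology X Y) g" "x \<in> X" "y \<in> Y"
  shows "continuous_map T euclideanreal (\<lambda>z. g z (x, y))"
  using assms by (simp add: DMC_topology_def continuous_map_in_subtopology continuous_map_componentwise)

lemma continuous_map_into_DMC: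
  assumes "\<And>z. z \<in> topspace T \<Longrightarrow> g z \<in> DMC X Y"
    and "\<And>x y. x \<in> X \<Longrightarrow> y \<in> Y \<Longrightarrow> continuous_map T euclideanreal (\<lambda>z. g z (x, y))"
  shows "continuous_map T (DMC_topology X Y) g"
  using assms
  by (auto simp: DMC_topology_def continuous_map_in_subtopology continuous_map_componentwise DMC_def)

lemma Hausdorff_space_DMC_topology: "Hausdorff_space (DMC_topology X Y)"
  by (simp add: DMC_topology_def Hausdorff_space_subtopology Hausdorff_space_product_topology)

text \<open>The channels form a closed subset of the cube of functions into \<open>{0..1}\<close>,
  which is compact by Tychonoff.\<close>

lemma compact_space_DMC_topology:
  assumes "finite X" "finite Y"
  shows "compact_space (DMC_topology X Y)"
proof -
  let ?P = "product_topology (\<lambda>_. euclideanreal) (X \<times> Y)"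
  let ?K = "PiE (X \<times> Y) (\<lambda>_. {0..1::real})"
  let ?S = "subtopology ?P ?K"
  have K: "compactin ?P ?K"
    by (simp add: compactin_PiE)
  \<comment> \<open>All row conditions are stated as one equation between continuous maps into a
    Hausdorff space; the restriction to \<open>X\<close> makes the row sums a point of that
    space.\<close>
  have "closedin ?S {W \<in> topspace ?S. (\<lambda>x\<in>X. \<Sum>y\<in>Y. W (x, y)) = (\<lambda>x\<in>X. 1)}"
  proof (rule closedin_continuous_maps_eq)
    show "Hausdorff_space (product_topology (\<lambda>_. euclideanreal) X)"
      by (simp add: Hausdorff_space_product_topology)
    show "continuous_map ?S (product_topology (\<lambda>_. euclideanreal) X) (\<lambda>W. \<lambda>x\<in>X. \<Sum>y\<in>Y. W (x, y))"
      using assms by (auto simp: continuous_map_componentwise intro!: continuous_intros)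
    show "continuous_map ?S (product_topology (\<lambda>_. euclideanreal) X) (\<lambda>W. \<lambda>x\<in>X. 1)"
      by simp
  qed
  also have "{W \<in> topspace ?S. (\<lambda>x\<in>X. \<Sum>y\<in>Y. W (x, y)) = (\<lambda>x\<in>X. 1)} = DMC X Y"
  proof -
    have "(\<lambda>x\<in>X. \<Sum>y\<in>Y. W (x, y)) = (\<lambda>x\<in>X. 1) \<longleftrightarrow> (\<forall>x\<in>X. (\<Sum>y\<in>Y. W (x, y)) = 1)"
      for W :: "('a, 'b) channel"
      by (auto simp: restrict_def fun_eq_iff)
    then have "{W \<in> topspace ?S. (\<lambda>x\<in>X. \<Sum>y\<in>Y. W (x, y)) = (\<lambda>x\<in>X. 1)} =
        {W \<in> ?K. \<forall>x\<in>X. (\<Sum>y\<in>Y. W (x, y)) = 1}"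
      by (simp add: PiE_mono Int_absorb1)
    moreover have "W \<in> ?K" if "W \<in> DMC X Y" for W
      using DMC_nonneg[OF that] DMC_le_1[OF assms(2) that] that
      by (simp add: PiE_iff DMC_def)
    moreover have "W \<in> DMC X Y" if "W \<in> ?K" "\<forall>x\<in>X. (\<Sum>y\<in>Y. W (x, y)) = 1" for W
      using that by (simp add: PiE_iff DMC_def)
    ultimately show ?thesis
      using DMC_sum[of _ X Y] by auto
  qed
  finally have "compactin ?S (DMC X Y)"
    using closedin_compact_space[OF compact_space_subtopology[OF K]] by blast
  then show ?thesis
    by (simp add: DMC_topology_def compactin_subtopology compact_space_subtopology)
qed

text \<open>
  The weights of the deterministic pairs form a channel out of a one-point alphabet; they range
  over a compact space, and the relation is the projection of a closed set along it.
\<close>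

lemma closedin_channel_contains:
  assumes fin: "finite X" "finite Y" "finite X'" "finite Y'"
  shows "closedin (prod_topology (DMC_topology X' Y') (DMC_topology X Y))
    {(W', W). channel_contains X' Y' W' X Y W}"
proof -
  define F where "F = (X \<rightarrow>\<^sub>E X') \<times> (Y' \<rightarrow>\<^sub>E Y)"
  \<comment> \<open>The restriction to \<open>X \<times> Y\<close> makes the equation
    \<open>W = mix \<mu> W'\<close> of functions equivalent to its entrywise form, since members of
    \<open>DMC X Y\<close> are extensional.\<close>
  define mix where "mix \<mu> W' = (\<lambda>(x, y)\<in>X \<times> Y.
      \<Sum>p\<in>F. \<mu> ((), p) * (\<Sum>y'\<in>Y'. of_bool (snd p y' = y) * W' (fst p x, y')))"
    for \<mu> and W' :: "('c, 'd) channel"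
  have finF: "finite F"
    using fin by (simp add: F_def finite_PiE)
  have FD: "fst p x \<in> X'" if "p \<in> F" "x \<in> X" for p x
    using that by (auto simp: F_def)
  let ?T = "prod_topology (DMC_topology X' Y') (DMC_topology X Y)"
  let ?D = "DMC_topology {()} F"
  let ?Z = "{z \<in> topspace (prod_topology ?T ?D). snd (fst z) = mix (snd z) (fst (fst z))}"
  have "closedin (prod_topology ?T ?D) ?Z"
  proof (rule closedin_continuous_maps_eq)
    show "Hausdorff_space (product_topology (\<lambda>_. euclideanreal) (X \<times> Y))"
      by (simp add: Hausdorff_space_product_topology)
    have fst1: "continuous_map (prod_topology ?T ?D) (DMC_topology X' Y') (\<lambda>z. fst (fst z))"
      and snd1: "continuous_map (prod_topology ?T ?D) (DMC_topology X Y) (\<lambda>z. snd (fst z))"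
      and snd2: "continuous_map (prod_topology ?T ?D) ?D snd"
      by (intro continuous_map_fst continuous_map_snd continuous_map_fst_of continuous_map_snd_of
          continuous_map_compose[OF continuous_map_fst, unfolded o_def])+
    show "continuous_map (prod_topology ?T ?D) (product_topology (\<lambda>_. euclideanreal) (X \<times> Y))
        (\<lambda>z. snd (fst z))"
      using snd1 by (simp add: DMC_topology_def continuous_map_in_subtopology)
    have "continuous_map (prod_topology ?T ?D) euclideanreal
        (\<lambda>z. mix (snd z) (fst (fst z)) (x, y))" if xy: "x \<in> X" "y \<in> Y" for x y
    proof -
      have "continuous_map (prod_topology ?T ?D) euclideanreal
          (\<lambda>z. \<Sum>p\<in>F. snd z ((), p) * (\<Sum>y'\<in>Y'. of_bool (snd p y' = y) * fst (fst z) (fst p x, y')))"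
        using finF fin FD xy
        by (intro continuous_map_sum continuous_map_real_mult
            continuous_map_DMC_component[OF fst1] continuous_map_DMC_component[OF snd2]) auto
      then show ?thesis
        using xy by (simp add: mix_def)
    qed
    then show "continuous_map (prod_topology ?T ?D) (product_topology (\<lambda>_. euclideanreal) (X \<times> Y))
        (\<lambda>z. mix (snd z) (fst (fst z)))"
      by (auto simp: continuous_map_componentwise mix_def)
  qed
  then have "closedin ?T (fst ` ?Z)"
    using Abstract_Topological_Spaces.closed_map_fst[of ?D ?T] compact_space_DMC_topology[of "{()}" F] finF
    unfolding closed_map_def by simp
  moreover have "fst ` ?Z = {(W', W). channel_contains X' Y' W' X Y W}"
  proof (intro subset_antisym subsetI)
    fix w
    assume "w \<in> fst ` ?Z"
    then obtain W' W \<mu> where w: "w = (W', W)" "W' \<in> DMC X' Y'" "W \<in> DMC X Y" "\<mu> \<in> DMC {()} F"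
        "W = mix \<mu> W'"
      by auto
    then have "channel_contains X' Y' W' X Y W"
      using fin finF
      by (intro channel_containsI[where I = F and \<mu> = "\<lambda>p. \<mu> ((), p)" and f = fst and g = snd])
        (auto simp: mix_def DMC_nonneg DMC_sum F_def simp del: sum_of_bool_mult_eq)
    then show "w \<in> {(W', W). channel_contains X' Y' W' X Y W}"
      using w by simp
  next
    fix w
    assume "w \<in> {(W', W). channel_contains X' Y' W' X Y W}"
    then obtain W' W where w: "w = (W', W)" and con: "channel_contains X' Y' W' X Y W"
      by auto
    obtain \<mu> where \<mu>: "\<And>p. p \<in> F \<Longrightarrow> 0 \<le> \<mu> p" "(\<Sum>p\<in>F. \<mu> p) = 1"
      and W: "\<And>x y. x \<in> X \<Longrightarrow> y \<in> Y \<Longrightarrow>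
        W (x, y) = (\<Sum>p\<in>F. \<mu> p * (\<Sum>y'\<in>Y'. of_bool (snd p y' = y) * W' (fst p x, y')))"
      by (rule channel_containsE[OF fin(1,3,2,4) con, folded F_def]) (use that in blast)
    define \<nu> where "\<nu> = (\<lambda>(u :: unit, p)\<in>{()} \<times> F. \<mu> p)"
    have D: "W' \<in> DMC X' Y'" "W \<in> DMC X Y"
      using con by (auto simp: channel_contains_def)
    have "\<nu> \<in> DMC {()} F"
      using \<mu> by (auto simp: DMC_def \<nu>_def)
    moreover have "W = mix \<nu> W'"
      using D(2) W by (auto simp: mix_def \<nu>_def DMC_def extensional_def fun_eq_iff simp del: sum_of_bool_mult_eq)
    ultimately have "((W', W), \<nu>) \<in> ?Z"
      using D by simp
    then show "w \<in> fst ` ?Z"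
      unfolding w by force
  qed
  ultimately show ?thesis
    by simp
qed

text \<open>Equivalence is containment intersected with its mirror image, and swapping the
  coordinates is continuous.\<close>

lemma closedin_shannon_rel:
  assumes "finite X" "finite Y"
  shows "closedin (prod_topology (DMC_topology X Y) (DMC_topology X Y)) (shannon_rel X Y)"
proof -
  let ?T = "prod_topology (DMC_topology X Y) (DMC_topology X Y)"
  let ?C = "{(W', W). channel_contains X Y W' X Y W}"
  have C: "closedin ?T ?C"
    by (rule closedin_channel_contains[OF assms assms])
  have "closedin ?T {z \<in> topspace ?T. prod.swap z \<in> ?C}"
    by (rule closedin_continuous_map_preimage[OF _ C])
      (simp add: prod.swap_def continuous_map_pairwise o_def continuous_map_fst continuous_map_snd)
  moreover have "shannon_rel X Y = ?C \<inter> {z \<in> topspace ?T. prod.swap z \<in> ?C}"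
    by (auto simp: shannon_rel_def shannon_equiv_def channel_contains_def)
  ultimately show ?thesis
    using C by auto
qed

section \<open>Quotients by Shannon equivalence and their products\<close>

lemma Hausdorff_space_DMC_s_topology:
  assumes "finite X" "finite Y"
  shows "Hausdorff_space (DMC_s_topology X Y)"
  unfolding DMC_s_topology_def using assms
  by (intro Hausdorff_space_quotient_topology)
    (simp_all add: equiv_shannon_rel compact_space_DMC_topology closedin_shannon_rel
      Hausdorff_space_DMC_topology)

lemma compact_space_DMC_s_topology:
  assumes "finite X" "finite Y"
  shows "compact_space (DMC_s_topology X Y)"
  unfolding DMC_s_topology_def
  using compact_space_DMC_topology[OF assms]
    quotient_map_quotient_topology[of "DMC_topology X Y" "shannon_rel X Y"]
  by (metis compact_space_def image_compactin quotient_imp_continuous_map quotient_imp_surjective_map)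

text \<open>A product of quotient maps need not be a quotient map, so only one factor is divided out
  at a time. In this order the factor kept fixed is first \<open>DMC_star_topology\<close> and then
  \<open>DMC_s_topology X Y\<close>, and both are locally compact Hausdorff.\<close>

lemma quotient_map_star_prod_DMC:
  assumes "finite X" "finite Y"
  shows "quotient_map (prod_topology DMC_star_topology (DMC_topology X Y))
     (prod_topology DMC_star_s_topology (DMC_s_topology X Y))
     (\<lambda>(p, W). (shannon_rel_star `` {p}, shannon_rel X Y `` {W}))"
proof -
  \<comment> \<open>Every component of the disjoint union is compact Hausdorff.\<close>
  have "locally_compact_space DMC_star_topology" "Hausdorff_space DMC_star_topology"
    unfolding DMC_star_topology_def
    by (auto simp: locally_compact_space_sum_topology compact_imp_locally_compact_space
        compact_space_DMC_topology Hausdorff_space_DMC_topology intro!: Hausdorff_space_sum_topology)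
  then have 1: "quotient_map (prod_topology DMC_star_topology (DMC_topology X Y))
     (prod_topology DMC_star_topology (DMC_s_topology X Y)) (\<lambda>(p, W). (p, shannon_rel X Y `` {W}))"
    unfolding DMC_s_topology_def
    by (intro quotient_map_prod_right quotient_map_quotient_topology) auto
  have 2: "quotient_map (prod_topology DMC_star_topology (DMC_s_topology X Y))
     (prod_topology DMC_star_s_topology (DMC_s_topology X Y)) (\<lambda>(p, C). (shannon_rel_star `` {p}, C))"
    using compact_space_DMC_s_topology[OF assms] Hausdorff_space_DMC_s_topology[OF assms]
    unfolding DMC_star_s_topology_def
    by (intro quotient_map_prod_left quotient_map_quotient_topology)
      (auto simp: compact_imp_locally_compact_space)
  show ?thesis
    using quotient_map_compose[OF 1 2] by (simp add: o_def case_prod_unfold)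
qed

section \<open>Continuity of operations on classes\<close>

text \<open>Each entry of the sum is an entry of \<open>W1\<close>, an entry of \<open>W2\<close>,
  or constantly 0.\<close>

lemma continuous_map_channel_sum:
  assumes "finite X1" "finite Y1" "finite X2" "finite Y2"
  shows "continuous_map (prod_topology (DMC_topology X1 Y1) (DMC_topology X2 Y2))
     (DMC_topology (X1 <+> X2) (Y1 <+> Y2)) (\<lambda>(W1, W2). channel_sum X1 Y1 X2 Y2 W1 W2)"
proof (rule continuous_map_into_DMC)
  fix z
  assume "z \<in> topspace (prod_topology (DMC_topology X1 Y1) (DMC_topology X2 Y2))"
  then show "(case z of (W1, W2) \<Rightarrow> channel_sum X1 Y1 X2 Y2 W1 W2) \<in> DMC (X1 <+> X2) (Y1 <+> Y2)"
    using assms by (auto intro: channel_sum_in_DMC)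
next
  fix x y
  assume "x \<in> X1 <+> X2" "y \<in> Y1 <+> Y2"
  then show "continuous_map (prod_topology (DMC_topology X1 Y1) (DMC_topology X2 Y2)) euclideanreal
      (\<lambda>z. (case z of (W1, W2) \<Rightarrow> channel_sum X1 Y1 X2 Y2 W1 W2) (x, y))"
    using continuous_map_DMC_component[OF continuous_map_fst]
      continuous_map_DMC_component[OF continuous_map_snd]
    by (elim PlusE) (simp_all add: case_prod_unfold)
qed

lemma continuous_map_channel_prod:
  "continuous_map (prod_topology (DMC_topology X1 Y1) (DMC_topology X2 Y2))
     (DMC_topology (X1 \<times> X2) (Y1 \<times> Y2)) (\<lambda>(W1, W2). channel_prod X1 Y1 X2 Y2 W1 W2)"
proof (rule continuous_map_into_DMC)
  fix z
  assume "z \<in> topspace (prod_topology (DMC_topology X1 Y1) (DMC_topology X2 Y2))"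
  then show "(case z of (W1, W2) \<Rightarrow> channel_prod X1 Y1 X2 Y2 W1 W2) \<in> DMC (X1 \<times> X2) (Y1 \<times> Y2)"
    by (auto intro: channel_prod_in_DMC)
next
  fix x y
  assume "x \<in> X1 \<times> X2" "y \<in> Y1 \<times> Y2"
  then show "continuous_map (prod_topology (DMC_topology X1 Y1) (DMC_topology X2 Y2)) euclideanreal
      (\<lambda>z. (case z of (W1, W2) \<Rightarrow> channel_prod X1 Y1 X2 Y2 W1 W2) (x, y))"
    using continuous_map_real_mult[OF continuous_map_DMC_component[OF continuous_map_fst]
      continuous_map_DMC_component[OF continuous_map_snd]]
    by (auto simp: case_prod_unfold)
qed

text \<open>The slices with a fixed tag form an open cover of the product, so continuity may be
  checked on each slice, where dropping the tag leads to
  \<open>prod_topology (X i) Z\<close>.\<close>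

lemma continuous_map_prod_sum_topology:
  assumes "\<And>i. i \<in> I \<Longrightarrow> continuous_map (prod_topology (X i) Z) Y (\<lambda>(x, z). f ((i, x), z))"
  shows "continuous_map (prod_topology (sum_topology X I) Z) Y f"
proof (rule pasting_lemma[where f = "\<lambda>_. f" and I = I
      and T = "\<lambda>i. ({i} \<times> topspace (X i)) \<times> topspace Z"])
  fix i
  assume i: "i \<in> I"
  let ?S = "sum_topology X I" and ?C = "{i} \<times> topspace (X i)"
  have op: "openin ?S ({i} \<times> U)" if "openin (X i) U" for U
  proof -
    have "openin ?S (Pair i ` U)"
      using open_map_component_injection[OF i, of X] that by (simp add: open_map_def)
    moreover have "Pair i ` U = {i} \<times> U"
      by auto
    ultimately show ?thesis
      by simp
  qed
  show "openin (prod_topology ?S Z) (?C \<times> topspace Z)"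
    by (simp add: openin_prod_Times_iff op)
  have "continuous_map (subtopology ?S ?C) (X i) snd"
    unfolding continuous_map_def
  proof (intro conjI allI impI)
    show "snd \<in> topspace (subtopology ?S ?C) \<rightarrow> topspace (X i)"
      by auto
    fix U
    assume U: "openin (X i) U"
    then have "{x \<in> topspace (subtopology ?S ?C). snd x \<in> U} = ({i} \<times> U) \<inter> ?C"
      using i openin_subset by fastforce
    then show "openin (subtopology ?S ?C) {x \<in> topspace (subtopology ?S ?C). snd x \<in> U}"
      using op[OF U] by (auto simp: openin_subtopology)
  qed
  then have "continuous_map (prod_topology (subtopology ?S ?C) Z) (prod_topology (X i) Z)
      (\<lambda>p. (snd (fst p), snd p))"
    by (intro continuous_map_pairedI continuous_map_snd
        continuous_map_compose[OF continuous_map_fst, unfolded o_def])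
  from continuous_map_compose[OF this assms[OF i]]
  have "continuous_map (prod_topology (subtopology ?S ?C) Z) Y (\<lambda>p. f ((i, snd (fst p)), snd p))"
    by (simp add: o_def)
  then have "continuous_map (prod_topology (subtopology ?S ?C) Z) Y f"
    by (rule continuous_map_eq) auto
  then show "continuous_map (subtopology (prod_topology ?S Z) (?C \<times> topspace Z)) Y f"
    by (simp add: prod_topology_subtopology(1) flip: subtopology_Times)
qed auto

section \<open>Transport of channels to the alphabets \<open>{1..n}\<close> and
  \<open>{1..m}\<close>\<close>

definition relabel ::
  "nat \<Rightarrow> nat \<Rightarrow> (nat \<Rightarrow> 'x) \<Rightarrow> (nat \<Rightarrow> 'y) \<Rightarrow> ('x, 'y) channel \<Rightarrow> (nat, nat) channel" where
  "relabel n m e d W = (\<lambda>(i, j)\<in>{1..n} \<times> {1..m}. W (e i, d j))"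

lemma relabel_in_DMC:
  assumes "bij_betw e {1..n} A" "bij_betw d {1..m} B" "W \<in> DMC A B"
  shows "relabel n m e d W \<in> DMC {1..n} {1..m}"
  using assms bij_betwE[OF assms(1)] bij_betwE[OF assms(2)]
    sum.reindex_bij_betw[OF assms(2), of "\<lambda>y. W (_, y)"]
  by (auto simp: DMC_def relabel_def)

lemma shannon_equiv_relabel:
  assumes e: "bij_betw e {1..n} A" and d: "bij_betw d {1..m} B" and W: "W \<in> DMC A B"
  shows "shannon_equiv A B W {1..n} {1..m} (relabel n m e d W)"
proof (rule shannon_equiv_bij_betw[OF _ _ _ _ W _ e d])
  show "finite A" "finite B"
    using e d bij_betw_finite by blast+
qed (use relabel_in_DMC[OF e d W] in \<open>auto simp: relabel_def\<close>)

lemma continuous_map_relabel: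
  assumes e: "bij_betw e {1..n} A" and d: "bij_betw d {1..m} B"
  shows "continuous_map (DMC_topology A B) (DMC_topology {1..n} {1..m}) (relabel n m e d)"
proof (rule continuous_map_into_DMC)
  show "relabel n m e d W \<in> DMC {1..n} {1..m}" if "W \<in> topspace (DMC_topology A B)" for W
    using relabel_in_DMC[OF e d] that by simp
  show "continuous_map (DMC_topology A B) euclideanreal (\<lambda>W. relabel n m e d W (i, j))"
    if "i \<in> {1..n}" "j \<in> {1..m}" for i j
    using continuous_map_DMC_component[OF continuous_map_id, of "e i" A "d j" B] that
      bij_betwE[OF e] bij_betwE[OF d]
    by (simp add: relabel_def)
qed

text \<open>Common core of the sum and the product: \<open>cont\<close> is continuity on
  representatives, \<open>cong\<close> is independence of the representatives. The operation is
  lifted to a continuous map \<open>s\<close> into tagged channels, and continuity descends along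
  the quotient map of \<open>quotient_map_star_prod_DMC\<close>.\<close>

lemma continuous_map_class_operation:
  fixes A :: "nat \<Rightarrow> 'u set" and B :: "nat \<Rightarrow> 'v set" and X2 :: "'a set" and Y2 :: "'b set"
    and oper :: "nat \<Rightarrow> nat \<Rightarrow> (nat, nat) channel \<Rightarrow> ('a, 'b) channel \<Rightarrow> ('u, 'v) channel"
  assumes fin: "finite X2" "finite Y2"
    and A: "\<And>n. 1 \<le> n \<Longrightarrow> finite (A n) \<and> A n \<noteq> {}" and B: "\<And>m. 1 \<le> m \<Longrightarrow> finite (B m) \<and> B m \<noteq> {}"
    and cont: "\<And>n m. 1 \<le> n \<Longrightarrow> 1 \<le> m \<Longrightarrow>
      continuous_map (prod_topology (DMC_topology {1..n} {1..m}) (DMC_topology X2 Y2))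
        (DMC_topology (A n) (B m)) (\<lambda>(W1, W2). oper n m W1 W2)"
    and cong: "\<And>n m n' m' W1 W1' W2 W2'. 1 \<le> n \<Longrightarrow> 1 \<le> m \<Longrightarrow> 1 \<le> n' \<Longrightarrow> 1 \<le> m' \<Longrightarrow>
      shannon_equiv {1..n'} {1..m'} W1' {1..n} {1..m} W1 \<Longrightarrow>
      shannon_equiv X2 Y2 W2' X2 Y2 W2 \<Longrightarrow>
      shannon_equiv (A n') (B m') (oper n' m' W1' W2') (A n) (B m) (oper n m W1 W2)"
  shows "continuous_map (prod_topology DMC_star_s_topology (DMC_s_topology X2 Y2)) DMC_star_s_topology
     (\<lambda>(C1, C2). {((n, m), W). ((n, m), W) \<in> DMC_star \<and>
        (\<exists>n1 m1 W1 W2. ((n1, m1), W1) \<in> C1 \<and> W2 \<in> C2 \<and>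
          shannon_equiv {1..n} {1..m} W (A n1) (B m1) (oper n1 m1 W1 W2))})"
    (is "continuous_map ?Q DMC_star_s_topology ?op")
proof -
  \<comment> \<open>The enumerations are chosen once for each alphabet size, independently of the
    channels; on each component \<open>s\<close> is therefore \<open>oper\<close> followed by a
    fixed relabelling.\<close>
  have "\<forall>n. \<exists>e. 1 \<le> n \<longrightarrow> bij_betw e {1..card (A n)} (A n)"
    using A ex_bij_betw_nat_finite_1 by blast
  then obtain e where e: "\<And>n. 1 \<le> n \<Longrightarrow> bij_betw (e n) {1..card (A n)} (A n)"
    by metis
  have "\<forall>m. \<exists>d. 1 \<le> m \<longrightarrow> bij_betw d {1..card (B m)} (B m)"
    using B ex_bij_betw_nat_finite_1 by blast
  then obtain d where d: "\<And>m. 1 \<le> m \<Longrightarrow> bij_betw (d m) {1..card (B m)} (B m)"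
    by metis
  \<comment> \<open>Components of the disjoint union have sizes at least 1, so the alphabets of the
    result must be non-empty.\<close>
  have card: "1 \<le> card (A n)" "1 \<le> card (B n)" if "1 \<le> n" for n
    using A[OF that] B[OF that] by (simp_all add: Suc_le_eq card_gt_0_iff)
  define s where "s = (\<lambda>(((n, m), W1), W2). ((card (A n), card (B m)),
      relabel (card (A n)) (card (B m)) (e n) (d m) (oper n m W1 W2)))"
  let ?T = "prod_topology DMC_star_topology (DMC_topology X2 Y2)"
  let ?q = "\<lambda>(p, W). (shannon_rel_star `` {p}, shannon_rel X2 Y2 `` {W})"
  have oper_DMC: "oper n m W1 W2 \<in> DMC (A n) (B m)"
    if "1 \<le> n" "1 \<le> m" "W1 \<in> DMC {1..n} {1..m}" "W2 \<in> DMC X2 Y2" for n m W1 W2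
    using funcset_mem[OF continuous_map_funspace[OF cont[OF that(1,2)]], of "(W1, W2)"] that by simp
  have "continuous_map ?T DMC_star_topology s"
    unfolding DMC_star_topology_def
  proof (rule continuous_map_prod_sum_topology)
    fix k :: "nat \<times> nat"
    assume "k \<in> {1..} \<times> {1..}"
    then obtain n m where k: "k = (n, m)" and nm: "n \<in> {1..}" "m \<in> {1..}"
      by blast
    let ?N = "card (A n)" and ?M = "card (B m)"
    have NM: "(?N, ?M) \<in> {1..} \<times> {1..}"
      using nm card by simp
    from nm have "continuous_map (prod_topology (DMC_topology {1..n} {1..m}) (DMC_topology X2 Y2))
        (DMC_topology {1..?N} {1..?M})
        (\<lambda>z. relabel ?N ?M (e n) (d m) (case z of (W1, W2) \<Rightarrow> oper n m W1 W2))"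
      using continuous_map_compose[OF cont continuous_map_relabel[OF e d], of n m] by (simp add: o_def)
    from continuous_map_compose[OF this continuous_map_component_injection[OF NM,
          of "\<lambda>(n, m). DMC_topology {1..n} {1..m}", unfolded prod.case]]
    show "continuous_map (prod_topology (case k of (n, m) \<Rightarrow> DMC_topology {1..n} {1..m}) (DMC_topology X2 Y2))
        (sum_topology (\<lambda>(n, m). DMC_topology {1..n} {1..m}) ({1..} \<times> {1..}))
        (\<lambda>(W1, W2). s ((k, W1), W2))"
      by (simp add: k o_def s_def case_prod_unfold)
  qed
  then have cont_class: "continuous_map ?T DMC_star_s_topology (\<lambda>z. shannon_rel_star `` {s z})"
    unfolding DMC_star_s_topology_def
    by (rule continuous_map_compose[unfolded o_def])
      (rule quotient_imp_continuous_map[OF quotient_map_quotient_topology])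
  \<comment> \<open>\<open>?op\<close> admits every choice of representatives, whereas
    \<open>s z\<close> is built from the given one; \<open>cong\<close> shows that both describe the
    same class.\<close>
  have "shannon_rel_star `` {s z} = ?op (?q z)" if z: "z \<in> topspace ?T" for z
  proof -
    obtain n m W1 W2 where zeq: "z = (((n, m), W1), W2)"
      by (metis surj_pair)
    with z have nm: "1 \<le> n" "1 \<le> m" and W: "W1 \<in> DMC {1..n} {1..m}" "W2 \<in> DMC X2 Y2"
      by (auto simp: DMC_star_def)
    let ?N = "card (A n)" and ?M = "card (B m)"
    let ?V = "relabel ?N ?M (e n) (d m) (oper n m W1 W2)"
    have V: "shannon_equiv (A n) (B m) (oper n m W1 W2) {1..?N} {1..?M} ?V"
      using shannon_equiv_relabel[OF e d oper_DMC] nm W by blast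
    have sz: "s z = ((?N, ?M), ?V)"
      by (simp add: s_def zeq)
    have "?V \<in> DMC {1..?N} {1..?M}"
      using V by (simp add: shannon_equiv_def channel_contains_def)
    then have sD: "((?N, ?M), ?V) \<in> DMC_star"
      using card nm by (simp add: DMC_star_def)
    have finAB: "finite (A n)" "finite (B n)" if "1 \<le> n" for n
      using A[OF that] B[OF that] by simp_all
    have "((n', m'), U) \<in> shannon_rel_star `` {s z} \<longleftrightarrow> ((n', m'), U) \<in> ?op (?q z)" for n' m' U
    proof
      assume "((n', m'), U) \<in> shannon_rel_star `` {s z}"
      then have U: "((n', m'), U) \<in> DMC_star" "shannon_equiv {1..?N} {1..?M} ?V {1..n'} {1..m'} U"
        by (auto simp: sz shannon_rel_star_def)
      have "shannon_equiv (A n) (B m) (oper n m W1 W2) {1..n'} {1..m'} U"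
        by (rule shannon_equiv_trans[OF _ _ _ _ _ _ V U(2)]) (use finAB nm in auto)
      moreover have "((n, m), W1) \<in> shannon_rel_star `` {((n, m), W1)}"
        using equiv_class_self[OF equiv_shannon_rel_star] z zeq by simp
      moreover have "W2 \<in> shannon_rel X2 Y2 `` {W2}"
        using equiv_class_self[OF equiv_shannon_rel[OF fin]] W by blast
      ultimately show "((n', m'), U) \<in> ?op (?q z)"
        using U(1) unfolding zeq prod.case mem_Collect_eq by (blast intro: shannon_equiv_sym)
    next
      assume "((n', m'), U) \<in> ?op (?q z)"
      then obtain n1 m1 U1 U2 where U: "((n', m'), U) \<in> DMC_star"
          "(((n, m), W1), ((n1, m1), U1)) \<in> shannon_rel_star" "(W2, U2) \<in> shannon_rel X2 Y2"
          "shannon_equiv {1..n'} {1..m'} U (A n1) (B m1) (oper n1 m1 U1 U2)"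
        by (auto simp: zeq)
      then have nm1: "1 \<le> n1" "1 \<le> m1"
        by (auto simp: shannon_rel_star_def DMC_star_def)
      \<comment> \<open>Any other representatives \<open>U1\<close>, \<open>U2\<close> are exchanged
        for \<open>W1\<close>, \<open>W2\<close>; the relabelled channel \<open>?V\<close> is then
        reached by transitivity.\<close>
      have "shannon_equiv (A n1) (B m1) (oper n1 m1 U1 U2) (A n) (B m) (oper n m W1 W2)"
        using U nm nm1
        by (intro cong) (auto simp: shannon_rel_star_def shannon_rel_def intro: shannon_equiv_sym)
      from shannon_equiv_trans[OF _ _ _ _ _ _ this V]
      have "shannon_equiv (A n1) (B m1) (oper n1 m1 U1 U2) {1..?N} {1..?M} ?V"
        using finAB nm nm1 by simp
      from shannon_equiv_trans[OF _ _ _ _ _ _ U(4) this]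
      have "shannon_equiv {1..n'} {1..m'} U {1..?N} {1..?M} ?V"
        using finAB nm1 by simp
      then show "((n', m'), U) \<in> shannon_rel_star `` {s z}"
        using U(1) sD shannon_equiv_sym by (auto simp: sz shannon_rel_star_def)
    qed
    then show ?thesis
      by (simp only: set_eq_iff split_paired_All) blast
  qed
  then have "continuous_map ?T DMC_star_s_topology (?op \<circ> ?q)"
    by (intro continuous_map_eq[OF cont_class]) simp
  then show ?thesis
    by (rule continuous_compose_quotient_map[OF quotient_map_star_prod_DMC[OF fin]])
qed

theorem proposition8:
  fixes X2 :: "'a set" and Y2 :: "'b set"
  assumes "finite X2" and "X2 \<noteq> {}" and "finite Y2" and "Y2 \<noteq> {}"
  shows "continuous_map (prod_topology DMC_star_s_topology (DMC_s_topology X2 Y2))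
           DMC_star_s_topology (\<lambda>(C1, C2). class_sum X2 Y2 C1 C2) \<and>
         continuous_map (prod_topology DMC_star_s_topology (DMC_s_topology X2 Y2))
           DMC_star_s_topology (\<lambda>(C1, C2). class_prod X2 Y2 C1 C2)"
  unfolding class_sum_def class_prod_def
proof
  show "continuous_map (prod_topology DMC_star_s_topology (DMC_s_topology X2 Y2)) DMC_star_s_topology
     (\<lambda>(C1, C2). {((n, m), W). ((n, m), W) \<in> DMC_star \<and>
        (\<exists>n1 m1 W1 W2. ((n1, m1), W1) \<in> C1 \<and> W2 \<in> C2 \<and>
          shannon_equiv {1..n} {1..m} W ({1..n1} <+> X2) ({1..m1} <+> Y2)
            (channel_sum {1..n1} {1..m1} X2 Y2 W1 W2))})"
    \<comment> \<open>Here \<open>A n\<close> is \<open>{1..n} <+> X2\<close> and \<open>B m\<close>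
      is \<open>{1..m} <+> Y2\<close>; congruence is \<open>channel_contains_sum\<close> used in
      both directions.\<close>
    by (rule continuous_map_class_operation)
      (use assms in \<open>auto simp: shannon_equiv_def intro!: continuous_map_channel_sum channel_contains_sum\<close>)
  show "continuous_map (prod_topology DMC_star_s_topology (DMC_s_topology X2 Y2)) DMC_star_s_topology
     (\<lambda>(C1, C2). {((n, m), W). ((n, m), W) \<in> DMC_star \<and>
        (\<exists>n1 m1 W1 W2. ((n1, m1), W1) \<in> C1 \<and> W2 \<in> C2 \<and>
          shannon_equiv {1..n} {1..m} W ({1..n1} \<times> X2) ({1..m1} \<times> Y2)
            (channel_prod {1..n1} {1..m1} X2 Y2 W1 W2))})"
    \<comment> \<open>The product alphabets \<open>{1..n} \<times> X2\<close> and
      \<open>{1..m} \<times> Y2\<close> are non-empty because \<open>X2\<close> and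
      \<open>Y2\<close> are.\<close>
    by (rule continuous_map_class_operation)
      (use assms in \<open>auto simp: shannon_equiv_def intro!: continuous_map_channel_prod channel_contains_prod\<close>)
qed

end
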